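(* Let $K$ be an arbitrary convex quadrilateral, and let $\boldsymbol\phi_{m,n}$, $\boldsymbol\psi_{m,n}$ be the vector fields on $K$ defined in the context. Then the following trace identities hold. (Interior modes) For $\boldsymbol\phi_{m,n}$ with $m,n\ge 2$, for $\boldsymbol\psi_{m,n}$ with $m\in\{2,4,5,6,\dots\}$, $n\ge 4$, and for $\boldsymbol\psi_{m,2}$ with $m\ge 4$: both the tangential trace and the curl trace vanish on all edges, i.e. $\boldsymbol\phi_{m,n}\cdot\boldsymbol\tau|_\Gamma=[0,0,0,0]=\nabla\times\boldsymbol\phi_{m,n}|_\Gamma$ and $\boldsymbol\psi_{m,n}\cdot\boldsymbol\tau|_\Gamma=[0,0,0,0]=\nabla\times\boldsymbol\psi_{m,n}|_\Gamma$. (Function edge modes) All the following fields have curl trace $[0,0,0,0]$, and their tangential traces are $$\boldsymbol\phi_{0,n}\cdot\boldsymbol\tau|_\Gamma=\Big[-\tfrac{(n-1)J^{0,0}_{n-1}(\hat y)}{l_1},0,0,0\Big]\ (n\ge2),\qquad \boldsymbol\phi_{0,0}\cdot\boldsymbol\tau|_\Gamma=\Big[-\tfrac1{l_1},0,0,0\Big],$$ $$\boldsymbol\phi_{m,0}\cdot\boldsymbol\tau|_\Gamma=\Big[0,\tfrac{(m-1)J^{0,0}_{m-1}(\hat x)}{l_2},0,0\Big]\ (m\ge2),\qquad \boldsymbol\phi_{1,0}\cdot\boldsymbol\tau|_\Gamma=\Big[0,\tfrac1{l_2},0,0\Big],$$ $$\boldsymbol\phi_{1,n}\cdot\boldsymbol\tau|_\Gamma=\Big[0,0,\tfrac{(n-1)J^{0,0}_{n-1}(\hat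 y)}{l_3},0\Big]\ (n\ge2),\qquad \boldsymbol\phi_{1,1}\cdot\boldsymbol\tau|_\Gamma=\Big[0,0,\tfrac1{l_3},0\Big],$$ $$\boldsymbol\phi_{m,1}\cdot\boldsymbol\tau|_\Gamma=\Big[0,0,0,-\tfrac{(m-1)J^{0,0}_{m-1}(\hat x)}{l_4}\Big]\ (m\ge2),\qquad \boldsymbol\phi_{0,1}\cdot\boldsymbol\tau|_\Gamma=\Big[0,0,0,-\tfrac1{l_4}\Big].$$ (Curl edge modes) For $m,n\in\{2,4,5,6,\dots\}$ the fields $\boldsymbol\psi_{1,n},\boldsymbol\psi_{m,1},\boldsymbol\psi_{3,n},\boldsymbol\psi_{m,3}$ have tangential trace $[0,0,0,0]$ and $$\nabla\times\boldsymbol\psi_{1,n}|_\Gamma=[(K^{-2,-2}_n)'(\hat y),0,0,0],\qquad \nabla\times\boldsymbol\psi_{m,1}|_\Gamma=[0,-(K^{-2,-2}_m)'(\hat x),0,0],$$ $$\nabla\times\boldsymbol\psi_{3,n}|_\Gamma=[0,0,(K^{-2,-2}_n)'(\hat y),0],\qquad \nabla\times\boldsymbol\psi_{m,3}|_\Gamma=[0,0,0,-(K^{-2,-2}_m)'(\hat x)].$$ (Vertex modes) The fields $\boldsymbol\psi_{0,0},\boldsymbol\psi_{0,1},\boldsymbol\psi_{1,1},\boldsymbol\psi_{1,0}$ have tangential trace $[0,0,0,0]$ and $$\nabla\times\boldsymbol\psi_{0,0}|_\Gamma=\Big[\tfrac{1-\hat y}2,\tfrac{1-\hat x}2,0,0\Big],\qquad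 \nabla\times\boldsymbol\psi_{0,1}|_\Gamma=\Big[0,\tfrac{1+\hat x}2,\tfrac{1-\hat y}2,0\Big],$$ $$\nabla\times\boldsymbol\psi_{1,1}|_\Gamma=\Big[0,0,\tfrac{1+\hat y}2,\tfrac{1+\hat x}2\Big],\qquad \nabla\times\boldsymbol\psi_{1,0}|_\Gamma=\Big[\tfrac{1+\hat y}2,0,0,\tfrac{1-\hat x}2\Big].$$
   Context: Geometry. $\hat K=(-1,1)^2$ is the reference square with coordinates $(\hat x,\hat y)$ and edges $\hat\Gamma_1=\{\hat x=-1\}$, $\hat\Gamma_2=\{\hat y=-1\}$, $\hat\Gamma_3=\{\hat x=1\}$, $\hat\Gamma_4=\{\hat y=1\}$. $K$ is a (nondegenerate) convex quadrilateral with vertices $P_i=(x_i,y_i)$, $1\le i\le4$, listed anticlockwise, with interior angle $\theta_i\in(0,\pi)$ at $P_i$; write $s_i=\sin\theta_i$. Its edges are $\Gamma_1=P_4P_1$, $\Gamma_2=P_1P_2$, $\Gamma_3=P_2P_3$, $\Gamma_4=P_3P_4$, and $l_i$ is the length of $\Gamma_i$. The bilinear map $\Phi_K:\hat K\to K$ is $\Phi_K(\hat x,\hat y)=\sum_{i=1}^4\sigma_i(\hat x,\hat y)(x_i,y_i)^{\mathsf T}$ with $\sigma_1=\frac{(1-\hat x)(1-\hat y)}4$, $\sigma_2=\frac{(1+\hat x)(1-\hat y)}4$, $\sigma_3=\frac{(1+\hat x)(1+\hat y)}4$, $\sigma_4=\frac{(1-\hat x)(1+\hat y)}4$; $B_K$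 is its Jacobian matrix with respect to $(\hat x,\hat y)$ and $J_K=\det B_K$. Conventions. $\boldsymbol\tau$ is the unit tangent to $\partial K$ oriented anticlockwise. For $\boldsymbol u=(u_1,u_2)^{\mathsf T}$, $\nabla\times\boldsymbol u=\partial_xu_2-\partial_yu_1$. $\hat\nabla$ is the gradient in $(\hat x,\hat y)$. For a function $g$ on $\overline K$, $g|_\Gamma=[g|_{\Gamma_1},g|_{\Gamma_2},g|_{\Gamma_3},g|_{\Gamma_4}]$, where the value on $\Gamma_i$ is expressed in the reference coordinates: the $i$-th entry is the value of $g$ at $\Phi_K(\hat x,\hat y)$ with $(\hat x,\hat y)\in\hat\Gamma_i$. Each vector field $\hat{\boldsymbol v}$ on $\hat K$ is associated with the field $\boldsymbol v=(B_K^{-\mathsf T}\hat{\boldsymbol v})\circ\Phi_K^{-1}$ on $K$; thus $\boldsymbol\phi_{m,n}$, $\boldsymbol\psi_{m,n}$ are obtained in this way from $\hat{\boldsymbol\phi}_{m,n}$, $\hat{\boldsymbol\psi}_{m,n}$ below. Generalized Jacobi polynomials. $J_n^{\alpha,\beta}$ is the classical Jacobi polynomial of degree $n$ for the weight $(1-\zeta)^\alpha(1+\zeta)^\beta$ on $[-1,1]$ (standard normalization; $J_n^{0,0}$ is the Legendre polynomial). $K_0^{-1,-1}=\frac{1-\zeta}2$, $K_1^{-1,-1}=\frac{1+\zeta}2$, $K_n^{-1,-1}=\frac{\zeta^2-1}4J_{n-2}^{1,1}(\zeta)$ for $n\ge2$. $K_0^{-2,-2}=\frac{(1-\zeta)^2(2+\zeta)}4$,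 $K_1^{-2,-2}=\frac{(1-\zeta)^2(1+\zeta)}4$, $K_2^{-2,-2}=\frac{(1+\zeta)^2(2-\zeta)}4$, $K_3^{-2,-2}=\frac{(1+\zeta)^2(\zeta-1)}4$, $K_n^{-2,-2}=\big(\frac{\zeta^2-1}4\big)^2J_{n-4}^{2,2}(\zeta)$ for $n\ge4$. A prime denotes $d/d\zeta$. Reference functions. Whenever $\max(m,n)\ge2$: $\hat{\boldsymbol\phi}_{m,n}=\hat\nabla[K_m^{-1,-1}(\hat x)K_n^{-1,-1}(\hat y)]$. Moreover $\hat{\boldsymbol\phi}_{0,0}=\big(\frac{\hat y(\hat y^2-1)(3\hat x^2-5)}{32},\,-\frac{\hat x(\hat x^2-1)(3\hat y^2-5)}{32}-\frac{\hat x-1}4\big)^{\mathsf T}$, $\hat{\boldsymbol\phi}_{1,0}=\big(-\frac{\hat y(\hat y^2-1)(3\hat x^2-5)}{32}-\frac{\hat y-1}4,\,\frac{\hat x(\hat x^2-1)(3\hat y^2-5)}{32}\big)^{\mathsf T}$, $\hat{\boldsymbol\phi}_{1,1}=\big(-\frac{\hat y(\hat y^2-1)(3\hat x^2-5)}{32},\,\frac{\hat x(\hat x^2-1)(3\hat y^2-5)}{32}+\frac{1+\hat x}4\big)^{\mathsf T}$, $\hat{\boldsymbol\phi}_{0,1}=\big(\frac{\hat y(\hat y^2-1)(3\hat x^2-5)}{32}+\frac{1+\hat y}4,\,-\frac{\hat x(\hat x^2-1)(3\hat y^2-5)}{32}\big)^{\mathsf T}$. Interior: $\hat{\boldsymbol\psi}_{m,n}=\hat\nabla[K_m^{-2,-2}(\hat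 x)]\,K_n^{-2,-2}(\hat y)$ for $m\in\{2,4,5,6,\dots\}$, $n\ge4$; $\hat{\boldsymbol\psi}_{m,2}=K_m^{-2,-2}(\hat x)\,\hat\nabla[K_2^{-2,-2}(\hat y)]$ for $m\ge4$. Curl edge, for $m,n\in\{2,4,5,6,\dots\}$: $\hat{\boldsymbol\psi}_{1,n}=J_K(\hat x,\hat y)K_1^{-2,-2}(\hat x)\hat\nabla[K_n^{-2,-2}(\hat y)]$, $\hat{\boldsymbol\psi}_{3,n}=J_K(\hat x,\hat y)K_3^{-2,-2}(\hat x)\hat\nabla[K_n^{-2,-2}(\hat y)]$, $\hat{\boldsymbol\psi}_{m,1}=J_K(\hat x,\hat y)\hat\nabla[K_m^{-2,-2}(\hat x)]K_1^{-2,-2}(\hat y)$, $\hat{\boldsymbol\psi}_{m,3}=J_K(\hat x,\hat y)\hat\nabla[K_m^{-2,-2}(\hat x)]K_3^{-2,-2}(\hat y)$. Vertex: $\hat{\boldsymbol\psi}_{0,0}=\big((\hat y-1)^2(1+\hat y)(\hat x-1)\frac{l_2(l_1s_1+2l_3s_2)\hat x+l_2(3l_1s_1+2l_3s_2)}{128},\ -(1+\hat x)(\hat y-1)(\hat x-1)^2\frac{l_1(l_2s_1+2l_4s_4)\hat y+l_1(3l_2s_1+2l_4s_4)}{128}\big)^{\mathsf T}$, $\hat{\boldsymbol\psi}_{0,1}=\big((\hat y-1)^2(1+\hat y)(\hat x+1)\frac{l_2(2l_1s_1+l_3s_2)\hat x-l_2(2l_1s_1+3l_3s_2)}{128},\ (1-\hat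 x)(\hat y-1)(1+\hat x)^2\frac{l_3(l_2s_2+2l_4s_3)\hat y+l_3(3l_2s_2+2l_4s_3)}{128}\big)^{\mathsf T}$, $\hat{\boldsymbol\psi}_{1,1}=\big((\hat y+1)^2(1-\hat y)(\hat x+1)\frac{-l_4(2l_1s_4+l_3s_3)\hat x+l_4(2l_1s_4+3l_3s_3)}{128},\ (1-\hat x)(\hat y+1)(\hat x+1)^2\frac{l_3(2l_2s_2+l_4s_3)\hat y-l_3(2l_2s_2+3l_4s_3)}{128}\big)^{\mathsf T}$, $\hat{\boldsymbol\psi}_{1,0}=\big((\hat y+1)^2(1-\hat y)(\hat x-1)\frac{-l_4(l_1s_4+2l_3s_3)\hat x-l_4(3l_1s_4+2l_3s_3)}{128},\ (1+\hat x)(\hat y+1)(\hat x-1)^2\frac{-l_1(2l_2s_1+l_4s_4)\hat y+l_1(2l_2s_1+3l_4s_4)}{128}\big)^{\mathsf T}$. *)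

theory Defs
  imports "HOL-Analysis.Analysis"
begin

section \<open>Generalized Jacobi polynomials\<close>

text \<open>Classical Jacobi polynomials in the standard normalization, with value \<open>(n + \<alpha>) gchoose n\<close>
  at 1; the family \<open>\<alpha> = \<beta> = 0\<close> consists of the Legendre polynomials.\<close>

definition jacobi_poly :: "real \<Rightarrow> real \<Rightarrow> nat \<Rightarrow> real \<Rightarrow> real" where
  "jacobi_poly \<alpha> \<beta> n z =
     (\<Sum>s\<le>n. ((real n + \<alpha>) gchoose (n - s)) * ((real n + \<beta>) gchoose s)
              * ((z - 1) / 2) ^ s * ((z + 1) / 2) ^ (n - s))"

text \<open>\<open>K11\<close> and \<open>K22\<close> carry the superscripts \<open>(-1,-1)\<close> and \<open>(-2,-2)\<close>.\<close>

definition K11 :: "nat \<Rightarrow> real \<Rightarrow> real" where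
  "K11 n z =
    (if n = 0 then (1 - z) / 2
     else if n = 1 then (1 + z) / 2
     else (z\<^sup>2 - 1) / 4 * jacobi_poly 1 1 (n - 2) z)"

definition K22 :: "nat \<Rightarrow> real \<Rightarrow> real" where
  "K22 n z =
    (if n = 0 then (1 - z)\<^sup>2 * (2 + z) / 4
     else if n = 1 then (1 - z)\<^sup>2 * (1 + z) / 4
     else if n = 2 then (1 + z)\<^sup>2 * (2 - z) / 4
     else if n = 3 then (1 + z)\<^sup>2 * (z - 1) / 4
     else ((z\<^sup>2 - 1) / 4)\<^sup>2 * jacobi_poly 2 2 (n - 4) z)"


section \<open>Quadrilaterals and the bilinear map\<close>

text \<open>The vertices are indexed by the four-element type \<open>4\<close>, whose arithmetic is modulo 4
  (so \<open>4 = 0\<close>): the predecessor of vertex 1 is vertex 4.  Edge \<open>i\<close> runs from vertex \<open>i - 1\<close> to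
  vertex \<open>i\<close>.\<close>

type_synonym quad = "4 \<Rightarrow> real^2"

text \<open>Nondegenerate, convex, vertices listed anticlockwise: with respect to each directed edge,
  the two vertices off that edge lie strictly to its left.\<close>

definition convex_quad :: "quad \<Rightarrow> bool" where
  "convex_quad P \<longleftrightarrow>
     (\<forall>i j. j \<noteq> i - 1 \<longrightarrow> j \<noteq> i \<longrightarrow>
        det (vector [P i - P (i - 1), P j - P (i - 1)] :: real^2^2) > 0)"

definition quad_interior :: "quad \<Rightarrow> (real^2) set" where
  "quad_interior P = interior (convex hull (range P))"

definition edge_length :: "quad \<Rightarrow> 4 \<Rightarrow> real" where
  "edge_length P i = dist (P (i - 1)) (P i)"

definition edge_tangent :: "quad \<Rightarrow> 4 \<Rightarrow> real^2" where
  "edge_tangent P i = (P i - P (i - 1)) /\<^sub>R edge_length P i"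

text \<open>For a convex quadrilateral the interior angle lies in \<open>(0, pi)\<close> and is therefore the
  unoriented angle between the two edges meeting at the vertex.\<close>

definition interior_angle :: "quad \<Rightarrow> 4 \<Rightarrow> real" where
  "interior_angle P i =
     arccos (((P (i + 1) - P i) \<bullet> (P (i - 1) - P i))
             / (norm (P (i + 1) - P i) * norm (P (i - 1) - P i)))"

definition ref_square :: "(real^2) set" where
  "ref_square = cbox (vector [-1, -1]) (vector [1, 1])"

definition ref_edge :: "4 \<Rightarrow> (real^2) set" where
  "ref_edge i =
     {q \<in> ref_square.
        if i = 1 then q$1 = -1
        else if i = 2 then q$2 = -1
        else if i = 3 then q$1 = 1
        else q$2 = 1}"

definition shape :: "4 \<Rightarrow> real^2 \<Rightarrow> real" where
  "shape i q =
     (if i = 1 then (1 - q$1) * (1 - q$2) / 4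
      else if i = 2 then (1 + q$1) * (1 - q$2) / 4
      else if i = 3 then (1 + q$1) * (1 + q$2) / 4
      else (1 - q$1) * (1 + q$2) / 4)"

definition bilinear_map :: "quad \<Rightarrow> real^2 \<Rightarrow> real^2" where
  "bilinear_map P q = (\<Sum>i\<in>UNIV. shape i q *\<^sub>R P i)"

definition B_mat :: "quad \<Rightarrow> real^2 \<Rightarrow> real^2^2" where
  "B_mat P q = jacobian (bilinear_map P) (at q)"

definition J_det :: "quad \<Rightarrow> real^2 \<Rightarrow> real" where
  "J_det P q = det (B_mat P q)"

text \<open>The field on the closed quadrilateral associated with a reference field; the bilinear map is
  inverted on the closed reference square so that boundary values are available.\<close>

definition covariant_map :: "quad \<Rightarrow> (real^2 \<Rightarrow> real^2) \<Rightarrow> real^2 \<Rightarrow> real^2" where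
  "covariant_map P v p =
     (let q = inv_into ref_square (bilinear_map P) p
      in transpose (matrix_inv (B_mat P q)) *v v q)"


section \<open>Differential operators and traces\<close>

definition grad :: "(real^2 \<Rightarrow> real) \<Rightarrow> real^2 \<Rightarrow> real^2" where
  "grad f q = (\<chi> i. frechet_derivative f (at q) (axis i 1))"

definition curl :: "(real^2 \<Rightarrow> real^2) \<Rightarrow> real^2 \<Rightarrow> real" where
  "curl u p = frechet_derivative u (at p) (axis 1 1) $ 2
            - frechet_derivative u (at p) (axis 2 1) $ 1"

text \<open>In both predicates component \<open>i\<close> of \<open>w q\<close> prescribes the trace at the image of the point \<open>q\<close>
  of the \<open>i\<close>-th (closed) reference edge.  The unit tangent on edge \<open>i\<close>, end points included, is
  that of edge \<open>i\<close>.  The curl is taken in the open quadrilateral, and its boundary values are those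
  of its (unique) continuous extension to the closure.\<close>

definition has_tangential_trace ::
    "quad \<Rightarrow> (real^2 \<Rightarrow> real^2) \<Rightarrow> (real^2 \<Rightarrow> real^4) \<Rightarrow> bool" where
  "has_tangential_trace P u w \<longleftrightarrow>
     (\<forall>i. \<forall>q\<in>ref_edge i. u (bilinear_map P q) \<bullet> edge_tangent P i = w q $ i)"

definition has_curl_trace ::
    "quad \<Rightarrow> (real^2 \<Rightarrow> real^2) \<Rightarrow> (real^2 \<Rightarrow> real^4) \<Rightarrow> bool" where
  "has_curl_trace P u w \<longleftrightarrow>
     (\<exists>g. continuous_on (closure (quad_interior P)) g
        \<and> (\<forall>p\<in>quad_interior P. u differentiable (at p) \<and> curl u p = g p)
        \<and> (\<forall>i. \<forall>q\<in>ref_edge i. g (bilinear_map P q) = w q $ i))"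


section \<open>The basis functions\<close>

definition phi_ref :: "nat \<Rightarrow> nat \<Rightarrow> real^2 \<Rightarrow> real^2" where
  "phi_ref m n q =
    (let x = q$1; y = q$2;
         a = y * (y\<^sup>2 - 1) * (3 * x\<^sup>2 - 5) / 32;
         b = x * (x\<^sup>2 - 1) * (3 * y\<^sup>2 - 5) / 32
     in if max m n \<ge> 2 then grad (\<lambda>r. K11 m (r$1) * K11 n (r$2)) q
        else if (m, n) = (0, 0) then vector [a, - b - (x - 1) / 4]
        else if (m, n) = (1, 0) then vector [- a - (y - 1) / 4, b]
        else if (m, n) = (1, 1) then vector [- a, b + (1 + x) / 4]
        else vector [a + (1 + y) / 4, - b])"

definition index_set :: "nat set" where
  "index_set = {2} \<union> {4..}"

definition psi_ref :: "quad \<Rightarrow> nat \<Rightarrow> nat \<Rightarrow> real^2 \<Rightarrow> real^2" where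
  "psi_ref P m n q =
    (let x = q$1; y = q$2; J = J_det P q;
         l1 = edge_length P 1; l2 = edge_length P 2;
         l3 = edge_length P 3; l4 = edge_length P 4;
         s1 = sin (interior_angle P 1); s2 = sin (interior_angle P 2);
         s3 = sin (interior_angle P 3); s4 = sin (interior_angle P 4)
     in if m \<in> index_set \<and> n \<ge> 4 then K22 n y *\<^sub>R grad (\<lambda>r. K22 m (r$1)) q
        else if m \<ge> 4 \<and> n = 2 then K22 m x *\<^sub>R grad (\<lambda>r. K22 2 (r$2)) q
        else if m = 1 \<and> n \<in> index_set then (J * K22 1 x) *\<^sub>R grad (\<lambda>r. K22 n (r$2)) q
        else if m = 3 \<and> n \<in> index_set then (J * K22 3 x) *\<^sub>R grad (\<lambda>r. K22 n (r$2)) q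
        else if m \<in> index_set \<and> n = 1 then (J * K22 1 y) *\<^sub>R grad (\<lambda>r. K22 m (r$1)) q
        else if m \<in> index_set \<and> n = 3 then (J * K22 3 y) *\<^sub>R grad (\<lambda>r. K22 m (r$1)) q
        else if (m, n) = (0, 0) then vector
          [(y - 1)\<^sup>2 * (1 + y) * (x - 1)
             * ((l2 * (l1 * s1 + 2 * l3 * s2) * x + l2 * (3 * l1 * s1 + 2 * l3 * s2)) / 128),
           - (1 + x) * (y - 1) * (x - 1)\<^sup>2
             * ((l1 * (l2 * s1 + 2 * l4 * s4) * y + l1 * (3 * l2 * s1 + 2 * l4 * s4)) / 128)]
        else if (m, n) = (0, 1) then vector
          [(y - 1)\<^sup>2 * (1 + y) * (x + 1)
             * ((l2 * (2 * l1 * s1 + l3 * s2) * x - l2 * (2 * l1 * s1 + 3 * l3 * s2)) / 128),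
           (1 - x) * (y - 1) * (1 + x)\<^sup>2
             * ((l3 * (l2 * s2 + 2 * l4 * s3) * y + l3 * (3 * l2 * s2 + 2 * l4 * s3)) / 128)]
        else if (m, n) = (1, 1) then vector
          [(y + 1)\<^sup>2 * (1 - y) * (x + 1)
             * ((- l4 * (2 * l1 * s4 + l3 * s3) * x + l4 * (2 * l1 * s4 + 3 * l3 * s3)) / 128),
           (1 - x) * (y + 1) * (x + 1)\<^sup>2
             * ((l3 * (2 * l2 * s2 + l4 * s3) * y - l3 * (2 * l2 * s2 + 3 * l4 * s3)) / 128)]
        else if (m, n) = (1, 0) then vector
          [(y + 1)\<^sup>2 * (1 - y) * (x - 1)
             * ((- l4 * (l1 * s4 + 2 * l3 * s3) * x - l4 * (3 * l1 * s4 + 2 * l3 * s3)) / 128),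
           (1 + x) * (y + 1) * (x - 1)\<^sup>2
             * ((- l1 * (2 * l2 * s1 + l4 * s4) * y + l1 * (2 * l2 * s1 + 3 * l4 * s4)) / 128)]
        else undefined)"

definition phi :: "quad \<Rightarrow> nat \<Rightarrow> nat \<Rightarrow> real^2 \<Rightarrow> real^2" where
  "phi P m n = covariant_map P (phi_ref m n)"

definition psi :: "quad \<Rightarrow> nat \<Rightarrow> nat \<Rightarrow> real^2 \<Rightarrow> real^2" where
  "psi P m n = covariant_map P (psi_ref P m n)"

end

theory Submission
  imports Defs "HOL-Computational_Algebra.Polynomial"
begin

text \<open>The covariant transformation \<open>v = (B\<^sup>-\<^sup>T v') \<circ> \<Phi>\<^sup>-\<^sup>1\<close> is made so that both traces can be read off
  on the reference square.  Let \<open>X\<close> and \<open>Y\<close> be the columns of the Jacobian matrix \<open>B\<close> of the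
  bilinear map \<open>\<Phi>\<close>.  By definition the transformed field \<open>u\<close> satisfies \<open>u \<bullet> X = v'\<^sub>1\<close> and
  \<open>u \<bullet> Y = v'\<^sub>2\<close> at image points; on each edge the tangent is, up to the factor
  \<open>\<plusminus> 2 / length\<close>, one of the two columns, so that the tangential trace is a boundary value of one
  component of the reference field (\<open>has_tangential_traceI\<close>).  Differentiating the two identities
  and subtracting, the second derivatives of \<open>\<Phi>\<close> cancel by symmetry and
  \<open>det B * curl u = \<partial>\<^sub>x v'\<^sub>2 - \<partial>\<^sub>y v'\<^sub>1\<close> remains (\<open>curl_covariant_map\<close>, \<open>has_curl_traceI\<close>).

  For this \<open>\<Phi>\<close> has to be a homeomorphism of the closed square onto the closed quadrilateral with
  nowhere vanishing Jacobian.  The Jacobian determinant is the bilinear interpolant of its four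
  corner values \<open>l\<^sub>i l\<^sub>i\<^sub>+\<^sub>1 sin \<theta>\<^sub>i / 4\<close>, which are positive by convexity
  (\<open>J_det_eq_sum_shape\<close>, \<open>sin_interior_angle\<close>).  Since \<open>\<Phi>\<close> is quadratic, a difference of two of its
  values is exactly \<open>B\<close>, taken at the midpoint, applied to the difference of the arguments, which
  gives injectivity (\<open>bilinear_map_diff\<close>).  Surjectivity onto the interior follows from
  connectedness, because edges are mapped to the boundary (\<open>quad_interior_eq\<close>).

  The modes are then checked on the reference square.  Gradient modes have vanishing curl, the
  four lowest order fields have a curl that vanishes on the boundary (\<open>cubic_mode_curl\<close>), and the
  tangential traces of the gradient modes come from
  \<open>(K\<^sub>n\<^sup>-\<^sup>1\<^sup>,\<^sup>-\<^sup>1)' = (n - 1) / 2 * J\<^sub>n\<^sub>-\<^sub>1\<^sup>0\<^sup>,\<^sup>0\<close> (\<open>deriv_K11\<close>).  For the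
  interior and edge curl modes only the values and first derivatives of the \<open>K\<^sub>n\<^sup>-\<^sup>2\<^sup>,\<^sup>-\<^sup>2\<close> at
  \<open>\<plusminus> 1\<close> matter; the factor \<open>det B\<close> in the edge modes cancels the one from the transformation.
  The four vertex modes are instances, by symmetry, of a single field whose reference curl on the
  two adjacent edges is \<open>det B\<close> times a linear hat function (\<open>vertex_field_curl\<close>).\<close>

section \<open>Vertex indices and the reference square\<close>

text \<open>The arithmetic of the index type reduces numerals modulo 4; the two rules bring what it leaves to
  a common normal form.\<close>
lemma index_simps: "(4::4) = 0" "(-1::4) = 3"
  by simp_all

lemma vector_4:
  "(vector [a, b, c, d] :: 'a::zero^4) $ 1 = a" "(vector [a, b, c, d] :: 'a^4) $ 2 = b"
  "(vector [a, b, c, d] :: 'a^4) $ 3 = c" "(vector [a, b, c, d] :: 'a^4) $ 4 = d"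
  unfolding vector_def by simp_all

definition wedge :: "real^2 \<Rightarrow> real^2 \<Rightarrow> real" where
  "wedge a b = a$1 * b$2 - a$2 * b$1"

lemma det_vector_2: "det (vector [a, b] :: real^2^2) = wedge a b"
  by (simp add: det_2 wedge_def)

lemma mem_ref_square: "q \<in> ref_square \<longleftrightarrow> -1 \<le> q$1 \<and> q$1 \<le> 1 \<and> -1 \<le> q$2 \<and> q$2 \<le> 1"
  by (auto simp: ref_square_def mem_box_cart forall_2)

definition open_square :: "(real^2) set" where
  "open_square = box (vector [-1, -1]) (vector [1, 1])"

lemma mem_open_square: "q \<in> open_square \<longleftrightarrow> -1 < q$1 \<and> q$1 < 1 \<and> -1 < q$2 \<and> q$2 < 1"
  by (auto simp: open_square_def mem_box_cart forall_2)

lemma open_open_square: "open open_square"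
  unfolding open_square_def by (rule open_box)

lemma open_square_subset: "open_square \<subseteq> ref_square"
  by (auto simp: mem_open_square mem_ref_square)

lemma ref_edge_subset: "ref_edge i \<subseteq> ref_square"
  by (auto simp: ref_edge_def)

section \<open>The bilinear map and its Jacobian\<close>

text \<open>The two columns of the Jacobian matrix of the bilinear map, i.e. its partial derivatives.\<close>
definition col_x :: "quad \<Rightarrow> real^2 \<Rightarrow> real^2" where
  "col_x P q = ((1 - q$2) / 4) *\<^sub>R (P 2 - P 1) + ((1 + q$2) / 4) *\<^sub>R (P 3 - P 4)"

definition col_y :: "quad \<Rightarrow> real^2 \<Rightarrow> real^2" where
  "col_y P q = ((1 - q$1) / 4) *\<^sub>R (P 4 - P 1) + ((1 + q$1) / 4) *\<^sub>R (P 3 - P 2)"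

lemma bilinear_map_eq:
  "bilinear_map P q = shape 1 q *\<^sub>R P 1 + shape 2 q *\<^sub>R P 2 + shape 3 q *\<^sub>R P 3 + shape 4 q *\<^sub>R P 4"
  unfolding bilinear_map_def sum_4 ..

lemma shape_simps:
  "shape 1 q = (1 - q$1) * (1 - q$2) / 4" "shape 2 q = (1 + q$1) * (1 - q$2) / 4"
  "shape 3 q = (1 + q$1) * (1 + q$2) / 4" "shape 4 q = (1 - q$1) * (1 + q$2) / 4"
  by (simp_all add: shape_def)

text \<open>The map is quadratic with only a mixed term, and
  \<open>x y - x' y'\<close> equals \<open>(x - x') (y + y') / 2 + (y - y') (x + x') / 2\<close>; hence the mean value identity
  is exact with the Jacobian at the midpoint.  This yields global injectivity.\<close>
lemma bilinear_map_diff: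
  "bilinear_map P q - bilinear_map P r =
     (q$1 - r$1) *\<^sub>R col_x P ((1/2) *\<^sub>R (q + r)) + (q$2 - r$2) *\<^sub>R col_y P ((1/2) *\<^sub>R (q + r))"
  unfolding vec_eq_iff bilinear_map_eq shape_simps col_x_def col_y_def
  by (simp add: field_simps)

lemma bilinear_map_has_derivative:
  "(bilinear_map P has_derivative (\<lambda>h. h$1 *\<^sub>R col_x P q + h$2 *\<^sub>R col_y P q)) (at q)"
proof -
  have comp: "((\<lambda>q. q$i) has_derivative (\<lambda>h. h$i)) (at q)" for i and q :: "real^2"
    by (intro bounded_linear.has_derivative[OF bounded_linear_vec_nth] has_derivative_ident)
  have "((\<lambda>q. shape 1 q *\<^sub>R P 1 + shape 2 q *\<^sub>R P 2 + shape 3 q *\<^sub>R P 3 + shape 4 q *\<^sub>R P 4)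
     has_derivative (\<lambda>h. h$1 *\<^sub>R col_x P q + h$2 *\<^sub>R col_y P q)) (at q)"
    unfolding shape_simps
    apply (rule derivative_eq_intros comp refl | simp)+
    apply (auto simp: vec_eq_iff fun_eq_iff col_x_def col_y_def field_simps)
    done
  then show ?thesis unfolding bilinear_map_eq[abs_def] .
qed

lemma continuous_on_bilinear_map: "continuous_on S (bilinear_map P)"
  by (meson bilinear_map_has_derivative has_derivative_continuous continuous_at_imp_continuous_on)

lemma B_mat_mult:
  "B_mat P q *v h = h$1 *\<^sub>R col_x P q + h$2 *\<^sub>R col_y P q"
proof -
  have "frechet_derivative (bilinear_map P) (at q) = (\<lambda>h. h$1 *\<^sub>R col_x P q + h$2 *\<^sub>R col_y P q)"
    using frechet_derivative_at[OF bilinear_map_has_derivative] by (rule sym)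
  moreover have "linear (\<lambda>h::real^2. h$1 *\<^sub>R col_x P q + h$2 *\<^sub>R col_y P q)"
    using bilinear_map_has_derivative has_derivative_linear by blast
  ultimately show ?thesis
    by (simp add: B_mat_def jacobian_def matrix_works)
qed

lemma J_det_eq_wedge: "J_det P q = wedge (col_x P q) (col_y P q)"
proof -
  have "B_mat P q $ i $ 1 = col_x P q $ i" "B_mat P q $ i $ 2 = col_y P q $ i" for i
    using B_mat_mult[of P q "axis 1 1", unfolded matrix_vector_mult_basis]
      B_mat_mult[of P q "axis 2 1", unfolded matrix_vector_mult_basis]
    by (simp_all add: column_def vec_eq_iff axis_def)
  then show ?thesis by (simp add: J_det_def det_2 wedge_def)
qed

text \<open>The value of the Jacobian determinant at the preimage of the vertex \<open>P i\<close>: there the columns are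
  half the edge vectors.\<close>
definition corner_jacobian :: "quad \<Rightarrow> 4 \<Rightarrow> real" where
  "corner_jacobian P i = wedge (P (i + 1) - P i) (P (i - 1) - P i) / 4"

lemma corner_jacobian_simps:
  "corner_jacobian P 1 = wedge (P 2 - P 1) (P 4 - P 1) / 4" "corner_jacobian P 2 = wedge (P 3 - P 2) (P 1 - P 2) / 4"
  "corner_jacobian P 3 = wedge (P 4 - P 3) (P 2 - P 3) / 4" "corner_jacobian P 4 = wedge (P 1 - P 4) (P 3 - P 4) / 4"
  by (simp_all add: corner_jacobian_def index_simps)

text \<open>The mixed terms of the determinant of two affine columns cancel, so the determinant is affine
  and is recovered from its corner values by bilinear interpolation.\<close>
lemma J_det_eq_sum_shape: "J_det P q = (\<Sum>i\<in>UNIV. shape i q * corner_jacobian P i)"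
  unfolding J_det_eq_wedge sum_4 shape_simps corner_jacobian_simps wedge_def col_x_def col_y_def
    vector_add_component vector_minus_component vector_scaleR_component real_scaleR_def
    by (simp add: algebra_simps add_divide_distrib diff_divide_distrib)

lemma edge_collinear:
  assumes "q \<in> ref_edge i"
  shows "wedge (P i - P (i - 1)) (bilinear_map P q) = wedge (P i - P (i - 1)) (P (i - 1))"
proof -
  have "wedge (P 1 - P 4) (bilinear_map P q) = wedge (P 1 - P 4) (P 4)" if "q$1 = -1"
    unfolding bilinear_map_eq shape_simps wedge_def that
    by (simp add: algebra_simps add_divide_distrib diff_divide_distrib)
  moreover have "wedge (P 2 - P 1) (bilinear_map P q) = wedge (P 2 - P 1) (P 1)" if "q$2 = -1"
    unfolding bilinear_map_eq shape_simps wedge_def that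
    by (simp add: algebra_simps add_divide_distrib diff_divide_distrib)
  moreover have "wedge (P 3 - P 2) (bilinear_map P q) = wedge (P 3 - P 2) (P 2)" if "q$1 = 1"
    unfolding bilinear_map_eq shape_simps wedge_def that
    by (simp add: algebra_simps add_divide_distrib diff_divide_distrib)
  moreover have "wedge (P 4 - P 3) (bilinear_map P q) = wedge (P 4 - P 3) (P 3)" if "q$2 = 1"
    unfolding bilinear_map_eq shape_simps wedge_def that
    by (simp add: algebra_simps add_divide_distrib diff_divide_distrib)
  ultimately show ?thesis
    using exhaust_4[of i] assms
    by (elim disjE) (simp_all add: ref_edge_def index_simps)
qed

lemma corner_jacobian_pos:
  assumes "convex_quad P" shows "corner_jacobian P i > 0"
proof -
  have "i - 1 \<noteq> i" "i - 1 \<noteq> i + 1" using exhaust_4[of i] by auto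
  then have "det (vector [P (i + 1) - P (i + 1 - 1), P (i - 1) - P (i + 1 - 1)] :: real^2^2) > 0"
    using assms unfolding convex_quad_def by (metis add_diff_cancel_right')
  then show ?thesis by (simp add: corner_jacobian_def det_vector_2)
qed

lemma shape_nonneg: "q \<in> ref_square \<Longrightarrow> shape i q \<ge> 0"
  by (auto simp: shape_def mem_ref_square)

lemma sum_shape: "(\<Sum>i\<in>UNIV. shape i q) = 1"
  by (simp add: sum_4 shape_simps field_simps)

lemma J_det_pos:
  assumes "convex_quad P" "q \<in> ref_square" shows "J_det P q > 0"
proof -
  have "\<exists>i. shape i q \<noteq> 0"
    using sum_shape[of q] by (metis sum.neutral zero_neq_one)
  then obtain i where "shape i q > 0"
    using shape_nonneg[OF assms(2)] by (metis less_eq_real_def)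
  then show ?thesis
    unfolding J_det_eq_sum_shape
    using shape_nonneg[OF assms(2)] corner_jacobian_pos[OF assms(1)]
    by (intro sum_pos2[of _ i]) (auto intro: mult_nonneg_nonneg less_imp_le)
qed

lemma wedge_lincomb_eq_0:
  assumes "wedge a b \<noteq> 0" "s *\<^sub>R a + t *\<^sub>R b = 0"
  shows "s = 0 \<and> t = 0"
proof -
  have "wedge (s *\<^sub>R a + t *\<^sub>R b) b = s * wedge a b" "wedge a (s *\<^sub>R a + t *\<^sub>R b) = t * wedge a b"
    by (simp_all add: wedge_def algebra_simps)
  then show ?thesis using assms by (simp add: wedge_def)
qed

section \<open>Parametrization of the quadrilateral\<close>

lemma inj_on_bilinear_map:
  assumes "convex_quad P" shows "inj_on (bilinear_map P) ref_square"
proof (rule inj_onI)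
  fix q r assume q: "q \<in> ref_square" and r: "r \<in> ref_square" and eq: "bilinear_map P q = bilinear_map P r"
  have "(1/2) *\<^sub>R (q + r) \<in> ref_square"
    using q r by (auto simp: mem_ref_square)
  then have "wedge (col_x P ((1/2) *\<^sub>R (q + r))) (col_y P ((1/2) *\<^sub>R (q + r))) \<noteq> 0"
    using J_det_pos[OF assms] J_det_eq_wedge by (metis less_irrefl)
  then have "q$1 - r$1 = 0 \<and> q$2 - r$2 = 0"
    by (rule wedge_lincomb_eq_0) (use bilinear_map_diff[of P q r] eq in simp)
  then show "q = r" by (simp add: vec_eq_iff forall_2)
qed

lemma bilinear_map_in_hull:
  assumes "q \<in> ref_square" shows "bilinear_map P q \<in> convex hull (range P)"
  unfolding bilinear_map_def
  using assms by (intro convex_sum) (auto simp: sum_shape shape_nonneg intro: hull_inc)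

text \<open>The line through the edge supports the convex hull, and the image of the reference edge
  lies on it.\<close>
lemma edge_not_interior:
  assumes "convex_quad P" "q \<in> ref_edge i"
  shows "bilinear_map P q \<notin> quad_interior P"
proof
  assume int: "bilinear_map P q \<in> quad_interior P"
  define e where "e = P i - P (i - 1)"
  \<comment> \<open>the inward normal of the edge, so that the inner product with it is \<open>wedge e\<close>\<close>
  define a :: "real^2" where "a = vector [- e$2, e$1]"
  have dot: "a \<bullet> p = wedge e p" for p
    by (simp add: a_def wedge_def inner_vec_def sum_2)
  have add: "wedge e (p - r) = wedge e p - wedge e r" for p r by (simp add: wedge_def algebra_simps)
  have pos: "wedge e (P j - P (i - 1)) > 0" if "j \<noteq> i" "j \<noteq> i - 1" for j
    using that assms(1) unfolding convex_quad_def e_def det_vector_2 by blast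
  have "i + 1 \<noteq> i" "i + 1 \<noteq> i - 1" using exhaust_4[of i] by auto
  then have "e \<noteq> 0" using pos[of "i + 1"] by (auto simp: wedge_def)
  then have "a \<noteq> 0" by (auto simp: a_def vec_eq_iff forall_2)
  have "wedge e (P j - P (i - 1)) \<ge> 0" for j
  proof (cases "j = i \<or> j = i - 1")
    case True then show ?thesis by (auto simp: e_def wedge_def)
  qed (use pos in force)
  then have "range P \<subseteq> {p. a \<bullet> p \<ge> wedge e (P (i - 1))}"
    by (auto simp: dot add)
  then have "convex hull (range P) \<subseteq> {p. a \<bullet> p \<ge> wedge e (P (i - 1))}"
    by (intro hull_minimal convex_halfspace_ge)
  then have "quad_interior P \<subseteq> {p. a \<bullet> p > wedge e (P (i - 1))}"
    unfolding quad_interior_def using interior_mono interior_halfspace_ge[OF \<open>a \<noteq> 0\<close>] by metis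
  with int have "wedge e (bilinear_map P q) > wedge e (P (i - 1))" by (auto simp: dot)
  moreover have "wedge e (bilinear_map P q) = wedge e (P (i - 1))"
    using edge_collinear[OF assms(2)] by (simp add: e_def)
  ultimately show False by simp
qed

lemma ref_square_cases:
  assumes "q \<in> ref_square" obtains "q \<in> open_square" | i where "q \<in> ref_edge i"
proof -
  have "q \<in> open_square \<or> q \<in> ref_edge 1 \<or> q \<in> ref_edge 2 \<or> q \<in> ref_edge 3 \<or> q \<in> ref_edge 4"
    using assms by (auto simp: ref_edge_def mem_open_square mem_ref_square)
  then show ?thesis using that by blast
qed

text \<open>The image of the open square is open by invariance of domain.  Within the connected interior
  of the quadrilateral it coincides with the compact image of the closed square, because edge points
  never land there.  An open and relatively closed nonempty subset is everything.\<close>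
lemma quad_interior_eq:
  assumes "convex_quad P"
  shows "quad_interior P = bilinear_map P ` open_square"
proof -
  let ?A = "bilinear_map P ` open_square" and ?B = "- (bilinear_map P ` ref_square)"
  have "open ?A"
    by (intro invariance_of_domain continuous_on_bilinear_map open_open_square
        inj_on_subset[OF inj_on_bilinear_map[OF assms] open_square_subset])
  have sub: "?A \<subseteq> quad_interior P"
    unfolding quad_interior_def
    using \<open>open ?A\<close> bilinear_map_in_hull open_square_subset by (intro interior_maximal) auto
  have "compact ref_square" by (simp add: ref_square_def compact_cbox)
  then have "open ?B"
    using compact_continuous_image[OF continuous_on_bilinear_map] by (simp add: compact_imp_closed open_Compl)
  moreover have "quad_interior P \<subseteq> ?A \<union> ?B"
    using edge_not_interior[OF assms] by (auto elim!: ref_square_cases)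
  moreover have "?A \<inter> ?B \<inter> quad_interior P = {}"
    using open_square_subset by auto
  moreover have "connected (quad_interior P)"
    unfolding quad_interior_def by (intro convex_connected convex_interior convex_convex_hull)
  moreover have "0 \<in> open_square" by (simp add: mem_open_square)
  then have "?A \<inter> quad_interior P \<noteq> {}" using sub by auto
  ultimately have "?B \<inter> quad_interior P = {}"
    using \<open>open ?A\<close> unfolding connected_def by blast
  then show ?thesis using sub \<open>quad_interior P \<subseteq> ?A \<union> ?B\<close> by blast
qed

text \<open>The definition of the angle yields its cosine; Lagrange's identity turns it into
  the absolute value of the determinant, which is positive because the vertices run anticlockwise.\<close>
lemma sin_interior_angle:
  assumes "convex_quad P"
  shows "edge_length P i * edge_length P (i + 1) * sin (interior_angle P i) = 4 * corner_jacobian P i"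
proof -
  define a b where "a = P (i + 1) - P i" and "b = P (i - 1) - P i"
  have w: "wedge a b > 0" using corner_jacobian_pos[OF assms, of i] by (simp add: corner_jacobian_def a_def b_def)
  then have "a \<noteq> 0" "b \<noteq> 0" by (auto simp: wedge_def)
  have lagrange: "(norm a * norm b)\<^sup>2 - (a \<bullet> b)\<^sup>2 = (wedge a b)\<^sup>2"
    unfolding power_mult_distrib power2_norm_eq_inner
    by (simp add: inner_vec_def sum_2 wedge_def power2_eq_square algebra_simps)
  define c where "c = (a \<bullet> b) / (norm a * norm b)"
  have "\<bar>a \<bullet> b\<bar> \<le> norm a * norm b" by (rule Cauchy_Schwarz_ineq2)
  then have c: "\<bar>c\<bar> \<le> 1" using \<open>a \<noteq> 0\<close> \<open>b \<noteq> 0\<close> by (simp add: c_def abs_mult)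
  have N: "norm a * norm b > 0" using \<open>a \<noteq> 0\<close> \<open>b \<noteq> 0\<close> by simp
  have "sin (interior_angle P i) = sqrt (1 - c\<^sup>2)"
    using c unfolding interior_angle_def a_def[symmetric] b_def[symmetric] c_def[symmetric]
    by (intro sin_arccos_abs)
  also have "1 - c\<^sup>2 = (wedge a b / (norm a * norm b))\<^sup>2"
    using \<open>a \<noteq> 0\<close> \<open>b \<noteq> 0\<close> unfolding power_divide lagrange[symmetric] c_def by (simp add: diff_divide_distrib)
  finally have "sin (interior_angle P i) = wedge a b / (norm a * norm b)"
    using w N by (simp add: real_sqrt_abs)
  moreover have "edge_length P i = norm b" "edge_length P (i + 1) = norm a"
    by (simp_all add: edge_length_def a_def b_def dist_norm norm_minus_commute)
  ultimately show ?thesis using \<open>a \<noteq> 0\<close> \<open>b \<noteq> 0\<close>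
    unfolding corner_jacobian_def a_def[symmetric] b_def[symmetric] by simp
qed

section \<open>Traces of covariantly transformed fields\<close>

lemma inv_bilinear_map:
  assumes "convex_quad P" "q \<in> ref_square"
  shows "inv_into ref_square (bilinear_map P) (bilinear_map P q) = q"
  using inv_into_f_f[OF inj_on_bilinear_map] assms by blast

text \<open>The defining property of the covariant transformation: the reference components are the
  inner products with the columns of the Jacobian matrix, since \<open>B\<^sup>-\<^sup>T v \<bullet> B h = v \<bullet> h\<close>.\<close>
lemma covariant_map_dot:
  assumes "convex_quad P" "q \<in> ref_square"
  shows "covariant_map P v (bilinear_map P q) \<bullet> col_x P q = v q $ 1"
    and "covariant_map P v (bilinear_map P q) \<bullet> col_y P q = v q $ 2"
proof -
  have "invertible (B_mat P q)"
    using J_det_pos[OF assms] by (simp add: invertible_det_nz J_det_def)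
  then have inv: "matrix_inv (B_mat P q) ** B_mat P q = mat 1"
    unfolding invertible_def matrix_inv_def by (rule someI_ex[THEN conjunct2])
  have dot: "covariant_map P v (bilinear_map P q) \<bullet> (B_mat P q *v h) = v q \<bullet> h" for h
    by (simp add: covariant_map_def Let_def inv_bilinear_map[OF assms] dot_lmul_matrix
        matrix_vector_mul_assoc inv)
  show "covariant_map P v (bilinear_map P q) \<bullet> col_x P q = v q $ 1"
    using dot[of "axis 1 1"] by (simp add: B_mat_mult axis_def inner_vec_def sum_2)
  show "covariant_map P v (bilinear_map P q) \<bullet> col_y P q = v q $ 2"
    using dot[of "axis 2 1"] by (simp add: B_mat_mult axis_def inner_vec_def sum_2)
qed

text \<open>On each edge one column of the Jacobian matrix is half the edge vector; its sign differs from
  the anticlockwise tangent on the left and on the top edge.\<close>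
lemma has_tangential_traceI:
  assumes P: "convex_quad P"
    and "\<And>q. q \<in> ref_square \<Longrightarrow> q$1 = -1 \<Longrightarrow> w q $ 1 = - (2 * v q $ 2 / edge_length P 1)"
    and "\<And>q. q \<in> ref_square \<Longrightarrow> q$2 = -1 \<Longrightarrow> w q $ 2 = 2 * v q $ 1 / edge_length P 2"
    and "\<And>q. q \<in> ref_square \<Longrightarrow> q$1 = 1 \<Longrightarrow> w q $ 3 = 2 * v q $ 2 / edge_length P 3"
    and "\<And>q. q \<in> ref_square \<Longrightarrow> q$2 = 1 \<Longrightarrow> w q $ 4 = - (2 * v q $ 1 / edge_length P 4)"
  shows "has_tangential_trace P (covariant_map P v) w"
proof -
  have "q$1 = -1 \<Longrightarrow> col_y P q = - (1/2) *\<^sub>R (P 1 - P 4)"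
    "q$2 = -1 \<Longrightarrow> col_x P q = (1/2) *\<^sub>R (P 2 - P 1)"
    "q$1 = 1 \<Longrightarrow> col_y P q = (1/2) *\<^sub>R (P 3 - P 2)"
    "q$2 = 1 \<Longrightarrow> col_x P q = - (1/2) *\<^sub>R (P 4 - P 3)" for q
    by (simp_all add: col_x_def col_y_def flip: scaleR_minus_right)
  moreover have "edge_tangent P 1 = (1 / edge_length P 1) *\<^sub>R (P 1 - P 4)"
    "edge_tangent P 2 = (1 / edge_length P 2) *\<^sub>R (P 2 - P 1)"
    "edge_tangent P 3 = (1 / edge_length P 3) *\<^sub>R (P 3 - P 2)"
    "edge_tangent P 4 = (1 / edge_length P 4) *\<^sub>R (P 4 - P 3)"
    by (simp_all add: edge_tangent_def index_simps inverse_eq_divide)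
  ultimately have tangent:
    "q$1 = -1 \<Longrightarrow> edge_tangent P 1 = (- 2 / edge_length P 1) *\<^sub>R col_y P q"
    "q$2 = -1 \<Longrightarrow> edge_tangent P 2 = (2 / edge_length P 2) *\<^sub>R col_x P q"
    "q$1 = 1 \<Longrightarrow> edge_tangent P 3 = (2 / edge_length P 3) *\<^sub>R col_y P q"
    "q$2 = 1 \<Longrightarrow> edge_tangent P 4 = (- 2 / edge_length P 4) *\<^sub>R col_x P q" for q
    by simp_all
  have "covariant_map P v (bilinear_map P q) \<bullet> edge_tangent P i = w q $ i" if "q \<in> ref_edge i" for i q
  proof -
    have q: "q \<in> ref_square" using that ref_edge_subset by blast
    note dots = covariant_map_dot[OF P q, of v]
    show ?thesis
      using exhaust_4[of i]
    proof (elim disjE)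
      assume i: "i = 1" then have "q$1 = -1" using that by (simp add: ref_edge_def)
      then show ?thesis using assms(2)[OF q] tangent(1) dots i by simp
    next
      assume i: "i = 2" then have "q$2 = -1" using that by (simp add: ref_edge_def)
      then show ?thesis using assms(3)[OF q] tangent(2) dots i by simp
    next
      assume i: "i = 3" then have "q$1 = 1" using that by (simp add: ref_edge_def)
      then show ?thesis using assms(4)[OF q] tangent(3) dots i by simp
    next
      assume i: "i = 4" then have "q$2 = 1" using that by (simp add: ref_edge_def)
      then show ?thesis using assms(5)[OF q] tangent(4) dots unfolding i by simp
    qed
  qed
  then show ?thesis by (simp add: has_tangential_trace_def)
qed

text \<open>Cramer's rule gives the inverse of the Jacobian matrix explicitly.\<close>
lemma inv_bilinear_map_has_derivative:
  assumes "convex_quad P" "q \<in> open_square"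
  shows "(inv_into ref_square (bilinear_map P) has_derivative
           (\<lambda>k. (wedge k (col_y P q) / J_det P q) *\<^sub>R axis 1 1 + (wedge (col_x P q) k / J_det P q) *\<^sub>R axis (2::2) 1))
         (at (bilinear_map P q))"
proof (rule has_derivative_inverse_strong[OF open_open_square assms(2) continuous_on_bilinear_map _
      bilinear_map_has_derivative])
  fix r assume "r \<in> open_square"
  then show "inv_into ref_square (bilinear_map P) (bilinear_map P r) = r"
    using inv_bilinear_map[OF assms(1)] open_square_subset by blast
next
  have J: "J_det P q \<noteq> 0" using J_det_pos[OF assms(1)] assms(2) open_square_subset by (metis less_irrefl subsetD)
  have "(wedge k (col_y P q) / J_det P q) * col_x P q $ i + (wedge (col_x P q) k / J_det P q) * col_y P q $ i = k $ i"
    if "i = 1 \<or> i = 2" for i and k :: "real^2"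
  proof -
    have "wedge k (col_y P q) * col_x P q $ i + wedge (col_x P q) k * col_y P q $ i = J_det P q * k $ i"
      using that by (elim disjE) (simp_all add: J_det_eq_wedge wedge_def algebra_simps)
    then have "(wedge k (col_y P q) * col_x P q $ i + wedge (col_x P q) k * col_y P q $ i) / J_det P q = k $ i"
      using J by simp
    then show ?thesis by (simp add: add_divide_distrib)
  qed
  then show "(\<lambda>h. h$1 *\<^sub>R col_x P q + h$2 *\<^sub>R col_y P q) \<circ>
      (\<lambda>k. (wedge k (col_y P q) / J_det P q) *\<^sub>R axis 1 1 + (wedge (col_x P q) k / J_det P q) *\<^sub>R axis (2::2) 1) = id"
    by (simp add: fun_eq_iff vec_eq_iff forall_2 axis_def)
qed

text \<open>The system of \<open>covariant_map_dot\<close> solved by Cramer's rule; this explicit form exhibits the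
  transformed field as a composition of differentiable maps.\<close>
lemma covariant_map_eq:
  assumes "convex_quad P" "q \<in> ref_square"
  shows "covariant_map P v (bilinear_map P q) =
    ((v q $ 1 * col_y P q $ 2 - v q $ 2 * col_x P q $ 2) / J_det P q) *\<^sub>R axis 1 1 +
    ((v q $ 2 * col_x P q $ 1 - v q $ 1 * col_y P q $ 1) / J_det P q) *\<^sub>R axis 2 1"
proof -
  define u where "u = covariant_map P v (bilinear_map P q)"
  have J: "J_det P q \<noteq> 0" using J_det_pos[OF assms] by simp
  have dots: "u$1 * col_x P q $ 1 + u$2 * col_x P q $ 2 = v q $ 1" "u$1 * col_y P q $ 1 + u$2 * col_y P q $ 2 = v q $ 2"
    using covariant_map_dot[OF assms, of v] by (simp_all add: u_def inner_vec_def sum_2)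
  have "u $ 1 * J_det P q = v q $ 1 * col_y P q $ 2 - v q $ 2 * col_x P q $ 2"
       "u $ 2 * J_det P q = v q $ 2 * col_x P q $ 1 - v q $ 1 * col_y P q $ 1"
    unfolding dots[symmetric] J_det_eq_wedge wedge_def by (simp_all add: algebra_simps)
  then have "u $ 1 = (v q $ 1 * col_y P q $ 2 - v q $ 2 * col_x P q $ 2) / J_det P q"
       "u $ 2 = (v q $ 2 * col_x P q $ 1 - v q $ 1 * col_y P q $ 1) / J_det P q"
    using J by (simp_all add: eq_divide_eq)
  then show ?thesis unfolding u_def[symmetric] by (simp add: vec_eq_iff forall_2 axis_def)
qed

lemma vec_nth_has_derivative:
  "((\<lambda>q::real^'n. q$i) has_derivative (\<lambda>h. h$i)) F"
  by (intro bounded_linear.has_derivative[OF bounded_linear_vec_nth] has_derivative_ident)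

text \<open>The mixed second derivative of the bilinear map, the only one that need not vanish.\<close>
definition twist :: "quad \<Rightarrow> real^2" where
  "twist P = (1/4) *\<^sub>R (P 1 - P 2 + P 3 - P 4)"

lemma col_x_has_derivative: "(col_x P has_derivative (\<lambda>h. h$2 *\<^sub>R twist P)) (at q)"
  unfolding col_x_def[abs_def]
  apply (rule derivative_eq_intros vec_nth_has_derivative refl | simp)+
  apply (auto simp: vec_eq_iff twist_def algebra_simps)
  done

lemma col_y_has_derivative: "(col_y P has_derivative (\<lambda>h. h$1 *\<^sub>R twist P)) (at q)"
  unfolding col_y_def[abs_def]
  apply (rule derivative_eq_intros vec_nth_has_derivative refl | simp)+
  apply (auto simp: vec_eq_iff twist_def algebra_simps)
  done

lemma vec_nth_differentiable:
  fixes f :: "real^'n \<Rightarrow> real^'m"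
  assumes "f differentiable (at q)" shows "(\<lambda>q. f q $ i) differentiable (at q)"
  by (rule differentiable_compose[OF bounded_linear_imp_differentiable[OF bounded_linear_vec_nth] assms])

lemma col_component_differentiable:
  "(\<lambda>q. col_x P q $ i) differentiable (at q)" "(\<lambda>q. col_y P q $ i) differentiable (at q)"
  by (rule vec_nth_differentiable[OF differentiableI[OF col_x_has_derivative]]
      vec_nth_differentiable[OF differentiableI[OF col_y_has_derivative]])+

lemma J_det_differentiable: "J_det P differentiable (at q)"
  unfolding J_det_eq_wedge[abs_def] wedge_def
  by (rule differentiable_diff[OF differentiable_mult differentiable_mult] col_component_differentiable)+

lemma covariant_map_differentiable:
  assumes P: "convex_quad P" and q: "q \<in> open_square" and v: "v differentiable (at q)"
  shows "covariant_map P v differentiable (at (bilinear_map P q))"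
proof -
  define \<Psi> where "\<Psi> = inv_into ref_square (bilinear_map P)"
  define F where "F = (\<lambda>q.
    ((v q $ 1 * col_y P q $ 2 - v q $ 2 * col_x P q $ 2) / J_det P q) *\<^sub>R axis 1 (1::real) +
    ((v q $ 2 * col_x P q $ 1 - v q $ 1 * col_y P q $ 1) / J_det P q) *\<^sub>R axis (2::2) 1)"
  have qs: "q \<in> ref_square" using q open_square_subset by blast
  have J: "J_det P q \<noteq> 0" using J_det_pos[OF P qs] by simp
  have vc: "(\<lambda>q. v q $ i) differentiable (at q)" for i
    using v by (rule vec_nth_differentiable)
  have det: "(\<lambda>q. (v q $ i * c q - v q $ j * d q) / J_det P q) differentiable (at q)"
    if "c differentiable (at q)" "d differentiable (at q)" for c d i j
  proof (rule differentiable_divide[OF _ J_det_differentiable J])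
    show "(\<lambda>q. v q $ i * c q - v q $ j * d q) differentiable (at q)"
      using that vc by (intro differentiable_diff differentiable_mult)
  qed
  have "F differentiable (at q)"
    unfolding F_def
  proof (rule differentiable_add)
    show "(\<lambda>q. ((v q $ 1 * col_y P q $ 2 - v q $ 2 * col_x P q $ 2) / J_det P q) *\<^sub>R axis 1 1 :: real^2) differentiable (at q)"
      using det[OF col_component_differentiable(2) col_component_differentiable(1)]
      by (rule differentiable_scaleR[OF _ differentiable_const])
    show "(\<lambda>q. ((v q $ 2 * col_x P q $ 1 - v q $ 1 * col_y P q $ 1) / J_det P q) *\<^sub>R axis 2 1 :: real^2) differentiable (at q)"
      using det[OF col_component_differentiable(1) col_component_differentiable(2)]
      by (rule differentiable_scaleR[OF _ differentiable_const])
  qed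
  moreover have "\<Psi> (bilinear_map P q) = q" using inv_bilinear_map[OF P qs] by (simp add: \<Psi>_def)
  moreover have "\<Psi> differentiable (at (bilinear_map P q))"
    using inv_bilinear_map_has_derivative[OF P q] unfolding \<Psi>_def by (rule differentiableI)
  ultimately have "(\<lambda>p. F (\<Psi> p)) differentiable (at (bilinear_map P q))"
    using differentiable_compose[of F \<Psi> "bilinear_map P q" UNIV] by simp
  then obtain D where D: "((\<lambda>p. F (\<Psi> p)) has_derivative D) (at (bilinear_map P q))"
    unfolding differentiable_def by blast
  have eq: "F (\<Psi> p) = covariant_map P v p" if "p \<in> quad_interior P" for p
  proof -
    from that obtain r where r: "r \<in> open_square" "p = bilinear_map P r"
      unfolding quad_interior_eq[OF P] by (rule imageE)
    then have rs: "r \<in> ref_square" using open_square_subset by blast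
    have "\<Psi> p = r" using inv_bilinear_map[OF P rs] by (simp add: \<Psi>_def r(2))
    then show ?thesis unfolding r(2) covariant_map_eq[OF P rs] by (simp only: F_def)
  qed
  have "(covariant_map P v has_derivative D) (at (bilinear_map P q))"
  proof (rule has_derivative_transform_within_open[OF D])
    show "open (quad_interior P)" by (simp add: quad_interior_def)
    show "bilinear_map P q \<in> quad_interior P" using q unfolding quad_interior_eq[OF P] by (rule imageI)
  qed (rule eq)
  then show ?thesis by (rule differentiableI)
qed

text \<open>Differentiate \<open>u(\<Phi>(q)) \<bullet> X(q) = v\<^sub>1(q)\<close> in the direction \<open>y\<close> and
  \<open>u(\<Phi>(q)) \<bullet> Y(q) = v\<^sub>2(q)\<close> in the direction \<open>x\<close>.  Both contain the term
  \<open>u \<bullet> twist\<close>, which drops out of the difference, and the antisymmetric part of \<open>D u\<close> on the pair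
  \<open>X, Y\<close> is the curl times \<open>det [X, Y]\<close>.\<close>
lemma curl_covariant_map:
  assumes P: "convex_quad P" and q: "q \<in> open_square" and v: "(v has_derivative v') (at q)"
  shows "J_det P q * curl (covariant_map P v) (bilinear_map P q) = v' (axis 1 1) $ 2 - v' (axis 2 1) $ 1"
proof -
  define u where "u = covariant_map P v"
  define D where "D = frechet_derivative u (at (bilinear_map P q))"
  define X Y where "X = col_x P q" and "Y = col_y P q"
  have "v differentiable (at q)" using v by (rule differentiableI)
  then have u: "(u has_derivative D) (at (bilinear_map P q))"
    using covariant_map_differentiable[OF P q] frechet_derivative_works unfolding u_def D_def by blast
  then have lin: "linear D" by (rule has_derivative_linear)
  have comp: "((\<lambda>r. u (bilinear_map P r)) has_derivative (\<lambda>h. D (h$1 *\<^sub>R X + h$2 *\<^sub>R Y))) (at q)"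
    unfolding X_def Y_def by (rule has_derivative_compose[OF bilinear_map_has_derivative u])
  have v1: "((\<lambda>r. u (bilinear_map P r) \<bullet> col_x P r) has_derivative (\<lambda>h. v' h $ 1)) (at q)"
  proof (rule has_derivative_transform_within_open[OF _ open_open_square q])
    show "((\<lambda>r. v r $ 1) has_derivative (\<lambda>h. v' h $ 1)) (at q)"
      by (rule bounded_linear.has_derivative[OF bounded_linear_vec_nth v])
    show "v r $ 1 = u (bilinear_map P r) \<bullet> col_x P r" if "r \<in> open_square" for r
      using covariant_map_dot(1)[OF P] that open_square_subset unfolding u_def by auto
  qed
  have v2: "((\<lambda>r. u (bilinear_map P r) \<bullet> col_y P r) has_derivative (\<lambda>h. v' h $ 2)) (at q)"
  proof (rule has_derivative_transform_within_open[OF _ open_open_square q])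
    show "((\<lambda>r. v r $ 2) has_derivative (\<lambda>h. v' h $ 2)) (at q)"
      by (rule bounded_linear.has_derivative[OF bounded_linear_vec_nth v])
    show "v r $ 2 = u (bilinear_map P r) \<bullet> col_y P r" if "r \<in> open_square" for r
      using covariant_map_dot(2)[OF P] that open_square_subset unfolding u_def by auto
  qed
  have "(\<lambda>h. v' h $ 1) = (\<lambda>h. u (bilinear_map P q) \<bullet> (h$2 *\<^sub>R twist P) + D (h$1 *\<^sub>R X + h$2 *\<^sub>R Y) \<bullet> X)"
    using has_derivative_unique[OF v1 has_derivative_inner[OF comp col_x_has_derivative]] by (simp add: X_def)
  from fun_cong[OF this, of "axis 2 1"]
  have e1: "v' (axis 2 1) $ 1 = u (bilinear_map P q) \<bullet> twist P + D Y \<bullet> X" by (simp add: axis_def)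
  have "(\<lambda>h. v' h $ 2) = (\<lambda>h. u (bilinear_map P q) \<bullet> (h$1 *\<^sub>R twist P) + D (h$1 *\<^sub>R X + h$2 *\<^sub>R Y) \<bullet> Y)"
    using has_derivative_unique[OF v2 has_derivative_inner[OF comp col_y_has_derivative]] by (simp add: Y_def)
  from fun_cong[OF this, of "axis 1 1"]
  have e2: "v' (axis 1 1) $ 2 = u (bilinear_map P q) \<bullet> twist P + D X \<bullet> Y" by (simp add: axis_def)
  have D: "D k = k$1 *\<^sub>R D (axis 1 1) + k$2 *\<^sub>R D (axis 2 1)" for k
  proof -
    have "k = k$1 *\<^sub>R axis 1 1 + k$2 *\<^sub>R axis 2 1" by (simp add: vec_eq_iff forall_2 axis_def)
    then have "D k = D (k$1 *\<^sub>R axis 1 1 + k$2 *\<^sub>R axis 2 1)" by (rule arg_cong)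
    then show ?thesis by (simp only: linear_add[OF lin] linear_cmul[OF lin])
  qed
  have "D X \<bullet> Y - D Y \<bullet> X = wedge X Y * (D (axis 1 1) $ 2 - D (axis 2 1) $ 1)"
    unfolding D[of X] D[of Y] by (simp add: inner_vec_def sum_2 wedge_def algebra_simps)
  then show ?thesis
    unfolding e1 e2 curl_def J_det_eq_wedge X_def[symmetric] Y_def[symmetric] u_def[symmetric] D_def[symmetric]
    by simp
qed

text \<open>The continuous extension of the curl is the reference curl divided by the Jacobian
  determinant, pulled back by the inverse of the bilinear map, which is continuous by compactness.\<close>
lemma has_curl_traceI:
  assumes P: "convex_quad P"
    and v1: "\<And>q. ((\<lambda>q. v q $ 1) has_derivative (\<lambda>h. a1 q * h$1 + a2 q * h$2)) (at q)"
    and v2: "\<And>q. ((\<lambda>q. v q $ 2) has_derivative (\<lambda>h. b1 q * h$1 + b2 q * h$2)) (at q)"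
    and cont: "continuous_on ref_square (\<lambda>q. b1 q - a2 q)"
    and "\<And>q. q \<in> ref_square \<Longrightarrow> q$1 = -1 \<Longrightarrow> b1 q - a2 q = J_det P q * w q $ 1"
    and "\<And>q. q \<in> ref_square \<Longrightarrow> q$2 = -1 \<Longrightarrow> b1 q - a2 q = J_det P q * w q $ 2"
    and "\<And>q. q \<in> ref_square \<Longrightarrow> q$1 = 1 \<Longrightarrow> b1 q - a2 q = J_det P q * w q $ 3"
    and "\<And>q. q \<in> ref_square \<Longrightarrow> q$2 = 1 \<Longrightarrow> b1 q - a2 q = J_det P q * w q $ 4"
  shows "has_curl_trace P (covariant_map P v) w"
proof -
  define g where "g = (\<lambda>p. let q = inv_into ref_square (bilinear_map P) p in (b1 q - a2 q) / J_det P q)"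
  have J: "J_det P q \<noteq> 0" if "q \<in> ref_square" for q using J_det_pos[OF P that] by simp
  have g: "g (bilinear_map P q) = (b1 q - a2 q) / J_det P q" if "q \<in> ref_square" for q
    by (simp add: g_def inv_bilinear_map[OF P that] Let_def)
  have v: "(v has_derivative (\<lambda>h. (a1 q * h$1 + a2 q * h$2) *\<^sub>R axis 1 1 + (b1 q * h$1 + b2 q * h$2) *\<^sub>R axis 2 1)) (at q)" for q
  proof -
    have "v = (\<lambda>q. (v q $ 1) *\<^sub>R axis 1 1 + (v q $ 2) *\<^sub>R axis 2 1)"
      by (simp add: fun_eq_iff vec_eq_iff forall_2 axis_def)
    moreover have "((\<lambda>q. (v q $ 1) *\<^sub>R axis (1::2) (1::real) + (v q $ 2) *\<^sub>R axis 2 1) has_derivative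
      (\<lambda>h. (a1 q * h$1 + a2 q * h$2) *\<^sub>R axis 1 1 + (b1 q * h$1 + b2 q * h$2) *\<^sub>R axis 2 1)) (at q)"
      by (intro has_derivative_add has_derivative_scaleR_left v1 v2)
    ultimately show ?thesis by simp
  qed
  have compact: "compact ref_square" unfolding ref_square_def by (rule compact_cbox)
  have inv: "continuous_on (bilinear_map P ` ref_square) (inv_into ref_square (bilinear_map P))"
    by (rule continuous_on_inv[OF continuous_on_bilinear_map compact]) (simp add: inv_bilinear_map[OF P])
  have "continuous_on ref_square (J_det P)"
    using J_det_differentiable
    by (intro continuous_at_imp_continuous_on ballI differentiable_imp_continuous_within)
  with J have quot: "continuous_on ref_square (\<lambda>q. (b1 q - a2 q) / J_det P q)"
    by (intro continuous_on_divide cont) auto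
  have contg: "continuous_on (bilinear_map P ` ref_square) g"
    unfolding g_def Let_def
    by (rule continuous_on_compose2[OF quot inv]) (auto simp: inv_bilinear_map[OF P])
  have "closed (bilinear_map P ` ref_square)"
    by (intro compact_imp_closed compact_continuous_image continuous_on_bilinear_map compact)
  then have "closure (quad_interior P) \<subseteq> bilinear_map P ` ref_square"
    unfolding quad_interior_eq[OF P] by (intro closure_minimal image_mono open_square_subset)
  with contg have 1: "continuous_on (closure (quad_interior P)) g" by (rule continuous_on_subset)
  have 2: "covariant_map P v differentiable (at p) \<and> curl (covariant_map P v) p = g p" if p: "p \<in> quad_interior P" for p
  proof -
    from p obtain q where q: "q \<in> open_square" and pq: "p = bilinear_map P q"
      unfolding quad_interior_eq[OF P] by (rule imageE)
    have qs: "q \<in> ref_square" using q open_square_subset by blast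
    have "v differentiable (at q)" using v by (rule differentiableI)
    moreover have "J_det P q * curl (covariant_map P v) p = b1 q - a2 q"
      using curl_covariant_map[OF P q v] unfolding pq by (simp add: axis_def)
    then have "curl (covariant_map P v) p = g p"
      using J[OF qs] unfolding pq g[OF qs] by (simp add: field_simps)
    ultimately show ?thesis using covariant_map_differentiable[OF P q] pq by simp
  qed
  have 3: "g (bilinear_map P q) = w q $ i" if "q \<in> ref_edge i" for i q
  proof -
    have q: "q \<in> ref_square" using that ref_edge_subset by blast
    have "b1 q - a2 q = J_det P q * w q $ i"
      using exhaust_4[of i]
    proof (elim disjE)
      assume i: "i = 1" then have "q$1 = -1" using that by (simp add: ref_edge_def)
      then show ?thesis using assms(5)[OF q] i by simp
    next
      assume i: "i = 2" then have "q$2 = -1" using that by (simp add: ref_edge_def)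
      then show ?thesis using assms(6)[OF q] i by simp
    next
      assume i: "i = 3" then have "q$1 = 1" using that by (simp add: ref_edge_def)
      then show ?thesis using assms(7)[OF q] i by simp
    next
      assume i: "i = 4" then have "q$2 = 1" using that by (simp add: ref_edge_def)
      then show ?thesis using assms(8)[OF q] i by simp
    qed
    then show ?thesis using J[OF q] unfolding g[OF q] by simp
  qed
  from 1 2 3 show ?thesis unfolding has_curl_trace_def by blast
qed

section \<open>Generalized Jacobi polynomials\<close>

text \<open>The Jacobi polynomial as a formal polynomial, so that derivatives of all orders exist and are
  given by \<open>pderiv\<close>.\<close>
definition jacobi_pol :: "real \<Rightarrow> real \<Rightarrow> nat \<Rightarrow> real poly" where
  "jacobi_pol \<alpha> \<beta> n =
     (\<Sum>s\<le>n. smult (((real n + \<alpha>) gchoose (n - s)) * ((real n + \<beta>) gchoose s))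
              ([:- 1/2, 1/2:] ^ s * [:1/2, 1/2:] ^ (n - s)))"

lemma poly_jacobi_pol: "poly (jacobi_pol \<alpha> \<beta> n) z = jacobi_poly \<alpha> \<beta> n z"
  by (simp add: jacobi_pol_def jacobi_poly_def poly_sum field_simps)

lemma K11_is_poly: "\<exists>p. K11 n = poly p"
proof (rule exI)
  show "K11 n = poly (if n = 0 then [:1/2, -1/2:] else if n = 1 then [:1/2, 1/2:]
     else [:-1/4, 0, 1/4:] * jacobi_pol 1 1 (n - 2))"
    by (auto simp: fun_eq_iff K11_def poly_jacobi_pol field_simps power2_eq_square)
qed

lemma K22_is_poly: "\<exists>p. K22 n = poly p"
proof (rule exI)
  show "K22 n = poly (if n = 0 then [:1, -1:]\<^sup>2 * [:1/2, 1/4:] else if n = 1 then [:1, -1:]\<^sup>2 * [:1/4, 1/4:]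
     else if n = 2 then [:1, 1:]\<^sup>2 * [:1/2, -1/4:] else if n = 3 then [:1, 1:]\<^sup>2 * [:-1/4, 1/4:]
     else [:-1/4, 0, 1/4:]\<^sup>2 * jacobi_pol 2 2 (n - 4))"
    by (auto simp: fun_eq_iff K22_def poly_jacobi_pol field_simps power2_eq_square)
qed

lemma K11_boundary:
  "K11 0 (-1) = 1" "K11 0 1 = 0" "K11 1 (-1) = 0" "K11 1 1 = 1"
  "n \<ge> 2 \<Longrightarrow> K11 n (-1) = 0" "n \<ge> 2 \<Longrightarrow> K11 n 1 = 0"
  by (simp_all add: K11_def)

lemma K22_boundary:
  "n \<ge> 4 \<Longrightarrow> K22 n (-1) = 0" "n \<ge> 4 \<Longrightarrow> K22 n 1 = 0"
  by (simp_all add: K22_def)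

lemma deriv_K22_boundary_odd:
  "deriv (K22 1) (-1) = 1" "deriv (K22 1) 1 = 0" "deriv (K22 3) (-1) = 0" "deriv (K22 3) 1 = 1"
proof -
  have "(K22 1 has_real_derivative (z - 1) * (3 * z + 1) / 4) (at z)" for z
    unfolding K22_def[abs_def] by (auto intro!: derivative_eq_intros simp: power2_eq_square field_simps)
  note d = this[THEN DERIV_imp_deriv]
  show "deriv (K22 1) (-1) = 1" "deriv (K22 1) 1 = 0" using d[of "-1"] d[of 1] by simp_all
  have "(K22 3 has_real_derivative (z + 1) * (3 * z - 1) / 4) (at z)" for z
    unfolding K22_def[abs_def] by (auto intro!: derivative_eq_intros simp: power2_eq_square field_simps)
  note d = this[THEN DERIV_imp_deriv]
  show "deriv (K22 3) (-1) = 0" "deriv (K22 3) 1 = 1" using d[of "-1"] d[of 1] by simp_all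
qed

text \<open>For \<open>n \<ge> 4\<close> the polynomial has double zeros at \<open>\<plusminus> 1\<close>; the Hermite function \<open>n = 2\<close>
  interpolates the values 0 and 1 there with vanishing slopes.\<close>
lemma deriv_K22_boundary:
  assumes "n \<in> index_set"
  shows "deriv (K22 n) (-1) = 0" "deriv (K22 n) 1 = 0"
proof -
  have "deriv (K22 n) (-1) = 0 \<and> deriv (K22 n) 1 = 0"
  proof (cases "n = 2")
    case True
    have "(K22 2 has_real_derivative 3 * (1 + z) * (1 - z) / 4) (at z)" for z
      unfolding K22_def[abs_def] by (auto intro!: derivative_eq_intros simp: power2_eq_square field_simps)
    note d = this[THEN DERIV_imp_deriv]
    show ?thesis using d[of "-1"] d[of 1] by (simp add: True)
  next
    case False
    then have n: "n \<ge> 4" using assms by (auto simp: index_set_def)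
    let ?J = "jacobi_pol 2 2 (n - 4)"
    have "K22 n = (\<lambda>z. ((z\<^sup>2 - 1) / 4)\<^sup>2 * poly ?J z)"
      using n by (simp add: fun_eq_iff K22_def poly_jacobi_pol)
    moreover have "((\<lambda>z. ((z\<^sup>2 - 1) / 4)\<^sup>2 * poly ?J z) has_real_derivative
        (z\<^sup>2 - 1) / 4 * (z * poly ?J z + (z\<^sup>2 - 1) / 4 * poly (pderiv ?J) z)) (at z)" for z
      by (auto intro!: derivative_eq_intros simp: power2_eq_square field_simps)
    ultimately have "(K22 n has_real_derivative
        (z\<^sup>2 - 1) / 4 * (z * poly ?J z + (z\<^sup>2 - 1) / 4 * poly (pderiv ?J) z)) (at z)" for z by simp
    note d = this[THEN DERIV_imp_deriv]
    show ?thesis using d[of "-1"] d[of 1] by simp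
  qed
  then show "deriv (K22 n) (-1) = 0" "deriv (K22 n) 1 = 0" by auto
qed

text \<open>With \<open>X = (z - 1) / 2\<close>, \<open>Y = (z + 1) / 2\<close> and \<open>N = n - 1\<close>, the polynomial is the sum of
  \<open>(N choose s+1) (N choose s) X\<^sup>s\<^sup>+\<^sup>1 Y\<^sup>N\<^sup>-\<^sup>s\<close>.  Its derivative collects, by the absorption identity
  \<open>(s+1) (N choose s+1) = (N-s) (N choose s)\<close>, the coefficients \<open>N-t\<close> and \<open>t\<close> times
  \<open>(N choose t)\<^sup>2 / 2\<close> at \<open>X\<^sup>t Y\<^sup>N\<^sup>-\<^sup>t\<close>, and these add up to \<open>N / 2\<close> times the Legendre polynomial.\<close>
lemma deriv_K11:
  assumes "n \<ge> 2"
  shows "deriv (K11 n) z = real (n - 1) / 2 * jacobi_poly 0 0 (n - 1) z"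
proof -
  obtain k where n: "n = Suc (Suc k)" using assms by (metis add_2_eq_Suc le_Suc_ex)
  define N where "N = Suc k"
  define X Y :: "real \<Rightarrow> real" where "X = (\<lambda>z. (z - 1) / 2)" and "Y = (\<lambda>z. (z + 1) / 2)"
  have dX: "(X has_real_derivative 1/2) (at z)" and dY: "(Y has_real_derivative 1/2) (at z)" for z
    unfolding X_def Y_def by (auto intro!: derivative_eq_intros)
  have gb: "(real N gchoose s) = real (N choose s)" for s
    by (simp add: binomial_gbinomial)
  have K: "K11 n z = (\<Sum>s\<le>k. real (N choose Suc s) * real (N choose s) * (X z ^ Suc s * Y z ^ (N - s)))" for z
  proof -
    have N: "real k + 1 = real N" by (simp add: N_def)
    have sym: "N choose (k - s) = N choose Suc s" if "s \<le> k" for s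
      using that binomial_symmetric[of "Suc s" N] by (simp add: N_def)
    have powN: "N - s = Suc (k - s)" if "s \<le> k" for s
      using that by (simp add: N_def Suc_diff_le)
    have "jacobi_poly 1 1 k z = (\<Sum>s\<le>k. real (N choose (k - s)) * real (N choose s) * X z ^ s * Y z ^ (k - s))"
      unfolding jacobi_poly_def N gb X_def Y_def ..
    moreover have "K11 n z = X z * Y z * jacobi_poly 1 1 k z"
      by (simp add: K11_def n X_def Y_def power2_eq_square field_simps)
    ultimately have "K11 n z = (X z * Y z) * (\<Sum>s\<le>k. real (N choose (k - s)) * real (N choose s) * X z ^ s * Y z ^ (k - s))"
      by simp
    also have "\<dots> = (\<Sum>s\<le>k. real (N choose Suc s) * real (N choose s) * (X z ^ Suc s * Y z ^ (N - s)))"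
      unfolding sum_distrib_left by (intro sum.cong) (simp_all add: sym powN)
    finally show ?thesis .
  qed
  \<comment> \<open>both sides equal \<open>N * (N - 1 choose s)\<close>\<close>
  have absorb: "real (Suc s) * real (N choose Suc s) = real (N - s) * real (N choose s)" for s
    unfolding of_nat_mult[symmetric] binomial_absorption binomial_absorb_comp ..
  define T where "T = (\<lambda>c t. c * real (N choose t) ^ 2 * (X z ^ t * Y z ^ (N - t)))"
  have summand: "real (N choose Suc s) * real (N choose s) *
      (real (Suc s) * X z ^ s * Y z ^ (N - s) + real (N - s) * X z ^ Suc s * Y z ^ (N - Suc s))
      = T (real (N - s)) s + T (real (Suc s)) (Suc s)" for s
  proof -
    have "real (N choose Suc s) * real (N choose s) *
      (real (Suc s) * X z ^ s * Y z ^ (N - s) + real (N - s) * X z ^ Suc s * Y z ^ (N - Suc s))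
      = (real (Suc s) * real (N choose Suc s)) * real (N choose s) * (X z ^ s * Y z ^ (N - s))
      + (real (N - s) * real (N choose s)) * real (N choose Suc s) * (X z ^ Suc s * Y z ^ (N - Suc s))"
      by (simp only: algebra_simps)
    also have "\<dots> = (real (N - s) * real (N choose s)) * real (N choose s) * (X z ^ s * Y z ^ (N - s))
      + (real (Suc s) * real (N choose Suc s)) * real (N choose Suc s) * (X z ^ Suc s * Y z ^ (N - Suc s))"
      by (simp only: absorb)
    finally show ?thesis by (simp add: T_def power2_eq_square)
  qed
  have pow: "((\<lambda>z. X z ^ Suc s * Y z ^ (N - s)) has_real_derivative
      (real (Suc s) * X z ^ s * Y z ^ (N - s) + real (N - s) * X z ^ Suc s * Y z ^ (N - Suc s)) / 2) (at z)" for s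
    by (rule DERIV_cong[OF DERIV_mult[OF DERIV_power[OF dX] DERIV_power[OF dY]]])
      (simp add: algebra_simps)
  have "((\<lambda>z. \<Sum>s\<le>k. real (N choose Suc s) * real (N choose s) * (X z ^ Suc s * Y z ^ (N - s)))
      has_real_derivative (\<Sum>s\<le>k. real (N choose Suc s) * real (N choose s) *
        ((real (Suc s) * X z ^ s * Y z ^ (N - s) + real (N - s) * X z ^ Suc s * Y z ^ (N - Suc s)) / 2))) (at z)"
    by (intro DERIV_sum DERIV_cmult pow)
  then have "(K11 n has_real_derivative (\<Sum>s\<le>k. T (real (N - s)) s + T (real (Suc s)) (Suc s)) / 2) (at z)"
    unfolding K[abs_def] times_divide_eq_right summand sum_divide_distrib .
  moreover have "(\<Sum>s\<le>k. T (real (N - s)) s) = (\<Sum>t\<le>N. T (real (N - t)) t)"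
    unfolding N_def sum.atMost_Suc by (simp add: T_def)
  moreover have "(\<Sum>s\<le>k. T (real (Suc s)) (Suc s)) = (\<Sum>t\<le>N. T (real t) t)"
    unfolding N_def sum.atMost_Suc_shift by (simp add: T_def)
  moreover have "T (real (N - t)) t + T (real t) t = T (real N) t" if "t \<le> N" for t
    using that by (simp add: T_def of_nat_diff algebra_simps)
  then have "(\<Sum>t\<le>N. T (real (N - t)) t) + (\<Sum>t\<le>N. T (real t) t) = (\<Sum>t\<le>N. T (real N) t)"
    unfolding sum.distrib[symmetric] by (intro sum.cong) auto
  moreover have "(\<Sum>t\<le>N. T (real N) t) = real N * jacobi_poly 0 0 N z"
    unfolding jacobi_poly_def sum_distrib_left T_def
    by (intro sum.cong)
      (auto simp: gb binomial_symmetric[symmetric] X_def Y_def power2_eq_square simp del: of_nat_mult)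
  ultimately show ?thesis
    by (simp add: sum.distrib DERIV_imp_deriv n N_def)
qed

section \<open>Curl traces of separable reference fields\<close>

lemma poly_nth_has_derivative:
  "((\<lambda>q::real^'n. poly p (q$i)) has_derivative (\<lambda>h. poly (pderiv p) (q$i) * h$i)) (at q)"
  using DERIV_compose_FDERIV[OF poly_DERIV vec_nth_has_derivative]
  by (simp add: mult.commute)

lemma separable_has_derivative:
  "((\<lambda>q::real^2. poly a (q$1) * poly b (q$2)) has_derivative
     (\<lambda>h. (poly (pderiv a) (q$1) * poly b (q$2)) * h$1 + (poly a (q$1) * poly (pderiv b) (q$2)) * h$2)) (at q)"
  by (rule has_derivative_eq_rhs[OF has_derivative_mult[OF poly_nth_has_derivative poly_nth_has_derivative]])
    (simp add: fun_eq_iff algebra_simps)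

lemma grad_eqI:
  assumes "(f has_derivative (\<lambda>h. a * h$1 + b * h$2)) (at q)"
  shows "grad f q = vector [a, b]"
  unfolding grad_def frechet_derivative_at[OF assms, symmetric]
  by (simp add: vec_eq_iff forall_2 axis_def)

lemma grad_separable:
  "grad (\<lambda>r. poly a (r$1) * poly b (r$2)) q =
     vector [poly (pderiv a) (q$1) * poly b (q$2), poly a (q$1) * poly (pderiv b) (q$2)]"
  by (rule grad_eqI[OF separable_has_derivative])

lemma grad_fst: "grad (\<lambda>r. poly a (r$1)) q = vector [poly (pderiv a) (q$1), 0]"
  using grad_separable[of a 1 q] by simp

lemma grad_snd: "grad (\<lambda>r. poly b (r$2)) q = vector [0, poly (pderiv b) (q$2)]"
  using grad_separable[of 1 b q] by simp

lemma deriv_poly: "deriv (poly p) z = poly (pderiv p) (z::real)"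
  by (rule DERIV_imp_deriv[OF poly_DERIV])

lemma continuous_on_poly_nth: "continuous_on S (\<lambda>q::real^'n. poly p (q$i))"
  by (intro continuous_intros continuous_on_poly)

text \<open>All fields except the four of lowest order have reference components of the form weight times
  polynomial in \<open>x\<close> times polynomial in \<open>y\<close>.  The weight is 1, or the Jacobian determinant for the
  edge modes of the curl.  The function \<open>C\<close> is the reference curl.\<close>
lemma weighted_curl_traceI:
  assumes P: "convex_quad P"
    and g: "\<And>q. (g has_derivative (\<lambda>h. gx q * h$1 + gy q * h$2)) (at q)"
    and gc: "continuous_on ref_square gx" "continuous_on ref_square gy"
    and v: "\<And>q. v q $ 1 = g q * (poly a (q$1) * poly b (q$2))"
      "\<And>q. v q $ 2 = g q * (poly c (q$1) * poly d (q$2))"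
    and C: "\<And>q. C q = gx q * (poly c (q$1) * poly d (q$2)) + g q * (poly (pderiv c) (q$1) * poly d (q$2))
       - gy q * (poly a (q$1) * poly b (q$2)) - g q * (poly a (q$1) * poly (pderiv b) (q$2))"
    and edges: "\<And>q. q \<in> ref_square \<Longrightarrow> q$1 = -1 \<Longrightarrow> C q = J_det P q * w q $ 1"
      "\<And>q. q \<in> ref_square \<Longrightarrow> q$2 = -1 \<Longrightarrow> C q = J_det P q * w q $ 2"
      "\<And>q. q \<in> ref_square \<Longrightarrow> q$1 = 1 \<Longrightarrow> C q = J_det P q * w q $ 3"
      "\<And>q. q \<in> ref_square \<Longrightarrow> q$2 = 1 \<Longrightarrow> C q = J_det P q * w q $ 4"
  shows "has_curl_trace P (covariant_map P v) w"
proof -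
  have prod: "((\<lambda>q. g q * (poly s (q$1) * poly t (q$2))) has_derivative
      (\<lambda>h. (gx q * (poly s (q$1) * poly t (q$2)) + g q * (poly (pderiv s) (q$1) * poly t (q$2))) * h$1 +
           (gy q * (poly s (q$1) * poly t (q$2)) + g q * (poly s (q$1) * poly (pderiv t) (q$2))) * h$2)) (at q)" for s t q
    by (rule has_derivative_eq_rhs[OF has_derivative_mult[OF g separable_has_derivative]])
      (simp add: fun_eq_iff algebra_simps)
  have "continuous_on ref_square g"
    using g has_derivative_continuous by (blast intro: continuous_at_imp_continuous_on)
  note cont = this gc continuous_on_poly_nth
  show ?thesis
    by (rule has_curl_traceI[OF P,
        where ?b1.0 = "\<lambda>q. gx q * (poly c (q$1) * poly d (q$2)) + g q * (poly (pderiv c) (q$1) * poly d (q$2))"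
        and ?a2.0 = "\<lambda>q. gy q * (poly a (q$1) * poly b (q$2)) + g q * (poly a (q$1) * poly (pderiv b) (q$2))"])
      (use edges in \<open>auto simp: v C diff_diff_eq intro!: prod continuous_on_diff continuous_on_add continuous_on_mult cont\<close>)
qed

lemma separable_curl_traceI:
  assumes P: "convex_quad P"
    and v: "\<And>q. v q $ 1 = poly a (q$1) * poly b (q$2)" "\<And>q. v q $ 2 = poly c (q$1) * poly d (q$2)"
    and C: "\<And>q. C q = poly (pderiv c) (q$1) * poly d (q$2) - poly a (q$1) * poly (pderiv b) (q$2)"
    and edges: "\<And>q. q \<in> ref_square \<Longrightarrow> q$1 = -1 \<Longrightarrow> C q = J_det P q * w q $ 1"
      "\<And>q. q \<in> ref_square \<Longrightarrow> q$2 = -1 \<Longrightarrow> C q = J_det P q * w q $ 2"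
      "\<And>q. q \<in> ref_square \<Longrightarrow> q$1 = 1 \<Longrightarrow> C q = J_det P q * w q $ 3"
      "\<And>q. q \<in> ref_square \<Longrightarrow> q$2 = 1 \<Longrightarrow> C q = J_det P q * w q $ 4"
  shows "has_curl_trace P (covariant_map P v) w"
  by (rule weighted_curl_traceI[OF P, where g = "\<lambda>_. 1" and gx = "\<lambda>_. 0" and gy = "\<lambda>_. 0",
        OF _ _ _ _ _ _ edges]) (simp_all add: v C)

lemma J_det_has_derivative:
  "(J_det P has_derivative (\<lambda>h. wedge (col_x P q) (twist P) * h$1 + wedge (twist P) (col_y P q) * h$2)) (at q)"
proof -
  have X: "((\<lambda>q. col_x P q $ i) has_derivative (\<lambda>h. h$2 * twist P $ i)) (at q)" for i
    using bounded_linear.has_derivative[OF bounded_linear_vec_nth col_x_has_derivative] by simp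
  have Y: "((\<lambda>q. col_y P q $ i) has_derivative (\<lambda>h. h$1 * twist P $ i)) (at q)" for i
    using bounded_linear.has_derivative[OF bounded_linear_vec_nth col_y_has_derivative] by simp
  show ?thesis
    unfolding J_det_eq_wedge[abs_def] wedge_def
    by (rule has_derivative_eq_rhs[OF has_derivative_diff[OF has_derivative_mult[OF X Y] has_derivative_mult[OF X Y]]])
      (simp add: fun_eq_iff algebra_simps)
qed

lemma continuous_on_wedge_col:
  "continuous_on S (\<lambda>q. wedge (col_x P q) u)" "continuous_on S (\<lambda>q. wedge u (col_y P q))"
  unfolding wedge_def col_x_def col_y_def by (auto intro!: continuous_intros)

text \<open>The common form of the four lowest order fields.  On the boundary of the square, where
  \<open>x\<^sup>2 = 1\<close> or \<open>y\<^sup>2 = 1\<close>, the curl of the nonlinear part has the constant value \<open>\<sigma> / 4\<close>, which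
  the linear part compensates.\<close>
lemma cubic_mode_curl:
  assumes P: "convex_quad P"
    and v: "\<And>q. v q $ 1 = \<sigma> * (q$2 * ((q$2)\<^sup>2 - 1) * (3 * (q$1)\<^sup>2 - 5) / 32) + \<alpha> + \<beta> * q$2"
      "\<And>q. v q $ 2 = - \<sigma> * (q$1 * ((q$1)\<^sup>2 - 1) * (3 * (q$2)\<^sup>2 - 5) / 32) + \<gamma> + \<delta> * q$1"
    and eq: "\<sigma> / 4 + \<delta> = \<beta>"
  shows "has_curl_trace P (covariant_map P v) (\<lambda>q. vector [0, 0, 0, 0])"
proof (rule has_curl_traceI[OF P,
    where ?a2.0 = "\<lambda>q. \<sigma> * ((3 * (q$2)\<^sup>2 - 1) * (3 * (q$1)\<^sup>2 - 5) / 32) + \<beta>"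
      and ?b1.0 = "\<lambda>q. - \<sigma> * ((3 * (q$1)\<^sup>2 - 1) * (3 * (q$2)\<^sup>2 - 5) / 32) + \<delta>"
      and ?a1.0 = "\<lambda>q. \<sigma> * (6 * q$1 * q$2 * ((q$2)\<^sup>2 - 1) / 32)"
      and ?b2.0 = "\<lambda>q. - \<sigma> * (6 * q$1 * q$2 * ((q$1)\<^sup>2 - 1) / 32)"])
  fix q :: "real^2"
  show "((\<lambda>q. v q $ 1) has_derivative
      (\<lambda>h. \<sigma> * (6 * q$1 * q$2 * ((q$2)\<^sup>2 - 1) / 32) * h$1 +
        (\<sigma> * ((3 * (q$2)\<^sup>2 - 1) * (3 * (q$1)\<^sup>2 - 5) / 32) + \<beta>) * h$2)) (at q)"
    unfolding v
    by (rule derivative_eq_intros vec_nth_has_derivative refl | simp)+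
      (simp add: fun_eq_iff power2_eq_square field_simps)
  show "((\<lambda>q. v q $ 2) has_derivative
      (\<lambda>h. (- \<sigma> * ((3 * (q$1)\<^sup>2 - 1) * (3 * (q$2)\<^sup>2 - 5) / 32) + \<delta>) * h$1 +
        - \<sigma> * (6 * q$1 * q$2 * ((q$1)\<^sup>2 - 1) / 32) * h$2)) (at q)"
    unfolding v
    by (rule derivative_eq_intros vec_nth_has_derivative refl | simp)+
      (simp add: fun_eq_iff power2_eq_square field_simps)
qed (use eq in \<open>auto intro!: continuous_intros simp: vector_4 field_simps\<close>)

section \<open>Gradient and lowest order modes\<close>

lemma phi_ref_gradient:
  assumes "max m n \<ge> 2" "K11 m = poly a" "K11 n = poly b"
  shows "phi_ref m n q =
    vector [poly (pderiv a) (q$1) * poly b (q$2), poly a (q$1) * poly (pderiv b) (q$2)]"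
  using assms by (simp add: phi_ref_def grad_separable)

lemma gradient_mode_component:
  assumes "max m n \<ge> 2"
  shows "phi_ref m n q $ 1 = deriv (K11 m) (q$1) * K11 n (q$2)"
    and "phi_ref m n q $ 2 = K11 m (q$1) * deriv (K11 n) (q$2)"
proof -
  obtain a b where ab: "K11 m = poly a" "K11 n = poly b" using K11_is_poly by metis
  show "phi_ref m n q $ 1 = deriv (K11 m) (q$1) * K11 n (q$2)"
    "phi_ref m n q $ 2 = K11 m (q$1) * deriv (K11 n) (q$2)"
    unfolding phi_ref_gradient[OF assms ab] unfolding ab deriv_poly by simp_all
qed

lemma gradient_mode_curl:
  assumes "convex_quad P" "max m n \<ge> 2"
  shows "has_curl_trace P (phi P m n) (\<lambda>q. vector [0, 0, 0, 0])"
proof -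
  obtain a b where ab: "K11 m = poly a" "K11 n = poly b" using K11_is_poly by metis
  show ?thesis
    unfolding phi_def
    by (rule separable_curl_traceI[OF assms(1), where a = "pderiv a" and b = b and c = a
          and d = "pderiv b" and C = "\<lambda>_. 0"])
      (simp_all add: phi_ref_gradient[OF assms(2) ab] vector_4)
qed

lemma gradient_interior_tangential:
  assumes "convex_quad P" "m \<ge> 2" "n \<ge> 2"
  shows "has_tangential_trace P (phi P m n) (\<lambda>q. vector [0, 0, 0, 0])"
  unfolding phi_def using assms
  by (intro has_tangential_traceI) (simp_all add: vector_4 gradient_mode_component K11_boundary)

lemma gradient_edge_tangential:
  assumes "convex_quad P" "n \<ge> 2"
  shows "has_tangential_trace P (phi P 0 n)
      (\<lambda>q. vector [- (real (n - 1) * jacobi_poly 0 0 (n - 1) (q$2) / edge_length P 1), 0, 0, 0])"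
    and "has_tangential_trace P (phi P n 0)
      (\<lambda>q. vector [0, real (n - 1) * jacobi_poly 0 0 (n - 1) (q$1) / edge_length P 2, 0, 0])"
    and "has_tangential_trace P (phi P 1 n)
      (\<lambda>q. vector [0, 0, real (n - 1) * jacobi_poly 0 0 (n - 1) (q$2) / edge_length P 3, 0])"
    and "has_tangential_trace P (phi P n 1)
      (\<lambda>q. vector [0, 0, 0, - (real (n - 1) * jacobi_poly 0 0 (n - 1) (q$1) / edge_length P 4)])"
proof -
  have "K11 (Suc 0) (- 1) = 0" "K11 (Suc 0) 1 = 1" by (simp_all add: K11_def)
  note simps = this vector_4 gradient_mode_component K11_boundary deriv_K11 max_def
  show "has_tangential_trace P (phi P 0 n)
      (\<lambda>q. vector [- (real (n - 1) * jacobi_poly 0 0 (n - 1) (q$2) / edge_length P 1), 0, 0, 0])"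
    unfolding phi_def using assms by (intro has_tangential_traceI) (simp_all add: simps)
  show "has_tangential_trace P (phi P n 0)
      (\<lambda>q. vector [0, real (n - 1) * jacobi_poly 0 0 (n - 1) (q$1) / edge_length P 2, 0, 0])"
    unfolding phi_def using assms by (intro has_tangential_traceI) (simp_all add: simps)
  show "has_tangential_trace P (phi P 1 n)
      (\<lambda>q. vector [0, 0, real (n - 1) * jacobi_poly 0 0 (n - 1) (q$2) / edge_length P 3, 0])"
    unfolding phi_def using assms by (intro has_tangential_traceI) (simp_all add: simps)
  show "has_tangential_trace P (phi P n 1)
      (\<lambda>q. vector [0, 0, 0, - (real (n - 1) * jacobi_poly 0 0 (n - 1) (q$1) / edge_length P 4)])"
    unfolding phi_def using assms by (intro has_tangential_traceI) (simp_all add: simps)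
qed

lemma lowest_order_curl:
  assumes P: "convex_quad P" and "m \<le> 1" "n \<le> 1"
  shows "has_curl_trace P (phi P m n) (\<lambda>q. vector [0, 0, 0, 0])"
proof -
  have "has_curl_trace P (phi P 0 0) (\<lambda>q. vector [0, 0, 0, 0])"
    unfolding phi_def
    by (rule cubic_mode_curl[OF P, where \<sigma> = 1 and \<alpha> = 0 and \<beta> = 0 and \<gamma> = "1/4" and \<delta> = "-1/4"])
      (simp_all add: phi_ref_def Let_def diff_divide_distrib)
  moreover have "has_curl_trace P (phi P 1 0) (\<lambda>q. vector [0, 0, 0, 0])"
    unfolding phi_def
    by (rule cubic_mode_curl[OF P, where \<sigma> = "-1" and \<alpha> = "1/4" and \<beta> = "-1/4" and \<gamma> = 0 and \<delta> = 0])
      (simp_all add: phi_ref_def Let_def diff_divide_distrib)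
  moreover have "has_curl_trace P (phi P 1 1) (\<lambda>q. vector [0, 0, 0, 0])"
    unfolding phi_def
    by (rule cubic_mode_curl[OF P, where \<sigma> = "-1" and \<alpha> = 0 and \<beta> = 0 and \<gamma> = "1/4" and \<delta> = "1/4"])
      (simp_all add: phi_ref_def Let_def add_divide_distrib diff_divide_distrib)
  moreover have "has_curl_trace P (phi P 0 1) (\<lambda>q. vector [0, 0, 0, 0])"
    unfolding phi_def
    by (rule cubic_mode_curl[OF P, where \<sigma> = 1 and \<alpha> = "1/4" and \<beta> = "1/4" and \<gamma> = 0 and \<delta> = 0])
      (simp_all add: phi_ref_def Let_def add_divide_distrib diff_divide_distrib)
  moreover have "m = 0 \<or> m = 1" "n = 0 \<or> n = 1" using assms by auto
  ultimately show ?thesis by (elim disjE) simp_all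
qed

lemma lowest_order_tangential:
  assumes P: "convex_quad P"
  shows "has_tangential_trace P (phi P 0 0) (\<lambda>q. vector [- (1 / edge_length P 1), 0, 0, 0])"
    and "has_tangential_trace P (phi P 1 0) (\<lambda>q. vector [0, 1 / edge_length P 2, 0, 0])"
    and "has_tangential_trace P (phi P 1 1) (\<lambda>q. vector [0, 0, 1 / edge_length P 3, 0])"
    and "has_tangential_trace P (phi P 0 1) (\<lambda>q. vector [0, 0, 0, - (1 / edge_length P 4)])"
  unfolding phi_def
  by (rule has_tangential_traceI[OF P]; simp add: phi_ref_def Let_def vector_4)+

section \<open>Interior and edge modes of the curl\<close>

lemma grad_K22:
  "grad (\<lambda>r. K22 m (r$1)) q = vector [deriv (K22 m) (q$1), 0]"
  "grad (\<lambda>r. K22 m (r$2)) q = vector [0, deriv (K22 m) (q$2)]"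
proof -
  obtain p where "K22 m = poly p" using K22_is_poly by metis
  then show "grad (\<lambda>r. K22 m (r$1)) q = vector [deriv (K22 m) (q$1), 0]"
    "grad (\<lambda>r. K22 m (r$2)) q = vector [0, deriv (K22 m) (q$2)]"
    by (simp_all add: grad_fst grad_snd deriv_poly)
qed

lemma psi_ref_components:
  "m \<in> index_set \<Longrightarrow> n \<ge> 4 \<Longrightarrow> psi_ref P m n q = vector [deriv (K22 m) (q$1) * K22 n (q$2), 0]"
  "m \<ge> 4 \<Longrightarrow> psi_ref P m 2 q = vector [0, K22 m (q$1) * deriv (K22 2) (q$2)]"
  "n \<in> index_set \<Longrightarrow> k = 1 \<or> k = 3 \<Longrightarrow>
     psi_ref P k n q = vector [0, J_det P q * (K22 k (q$1) * deriv (K22 n) (q$2))]"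
  "m \<in> index_set \<Longrightarrow> k = 1 \<or> k = 3 \<Longrightarrow>
     psi_ref P m k q = vector [J_det P q * (deriv (K22 m) (q$1) * K22 k (q$2)), 0]"
proof -
  have smult: "r *\<^sub>R (vector [a, b] :: real^2) = vector [r * a, r * b]" for r a b :: real
    by (simp add: vec_eq_iff forall_2)
  show "psi_ref P m n q = vector [deriv (K22 m) (q$1) * K22 n (q$2), 0]" if "m \<in> index_set" "n \<ge> 4"
    using that by (simp add: psi_ref_def Let_def grad_K22 smult mult.commute)
  show "psi_ref P m 2 q = vector [0, K22 m (q$1) * deriv (K22 2) (q$2)]" if "m \<ge> 4"
    using that by (simp add: psi_ref_def Let_def grad_K22 smult)
  have notin: "1 \<notin> index_set" "3 \<notin> index_set" by (simp_all add: index_set_def)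
  show "psi_ref P k n q = vector [0, J_det P q * (K22 k (q$1) * deriv (K22 n) (q$2))]"
    if "n \<in> index_set" "k = 1 \<or> k = 3"
    using that(2)
  proof
    assume "k = 1"
    then show ?thesis using that(1) notin
      by (simp add: psi_ref_def Let_def grad_K22 smult mult.assoc)
  next
    assume "k = 3"
    then show ?thesis using that(1) notin
      by (simp add: psi_ref_def Let_def grad_K22 smult mult.assoc)
  qed
  show "psi_ref P m k q = vector [J_det P q * (deriv (K22 m) (q$1) * K22 k (q$2)), 0]"
    if "m \<in> index_set" "k = 1 \<or> k = 3"
  proof -
    have "m \<noteq> 1" "m \<noteq> 3" using that(1) notin by auto
    with that(2) show ?thesis
    proof (elim disjE)
      assume "k = 1"
      with \<open>m \<noteq> 1\<close> \<open>m \<noteq> 3\<close> show ?thesis using that(1)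
        by (simp add: psi_ref_def Let_def grad_K22 smult mult_ac)
    next
      assume "k = 3"
      with \<open>m \<noteq> 1\<close> \<open>m \<noteq> 3\<close> show ?thesis using that(1)
        by (simp add: psi_ref_def Let_def grad_K22 smult mult_ac)
    qed
  qed
qed

lemma interior_curl_mode:
  assumes P: "convex_quad P"
  shows "m \<in> index_set \<Longrightarrow> n \<ge> 4 \<Longrightarrow> has_tangential_trace P (psi P m n) (\<lambda>q. vector [0, 0, 0, 0])"
    and "m \<in> index_set \<Longrightarrow> n \<ge> 4 \<Longrightarrow> has_curl_trace P (psi P m n) (\<lambda>q. vector [0, 0, 0, 0])"
    and "m \<ge> 4 \<Longrightarrow> has_tangential_trace P (psi P m 2) (\<lambda>q. vector [0, 0, 0, 0])"
    and "m \<ge> 4 \<Longrightarrow> has_curl_trace P (psi P m 2) (\<lambda>q. vector [0, 0, 0, 0])"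
proof -
  have two: "2 \<in> index_set" and four: "m \<ge> 4 \<Longrightarrow> m \<in> index_set" for m by (auto simp: index_set_def)
  show "has_tangential_trace P (psi P m n) (\<lambda>q. vector [0, 0, 0, 0])" if "m \<in> index_set" "n \<ge> 4"
    unfolding psi_def using that
    by (intro has_tangential_traceI[OF P]) (simp_all add: psi_ref_components vector_4 K22_boundary)
  show "has_tangential_trace P (psi P m 2) (\<lambda>q. vector [0, 0, 0, 0])" if "m \<ge> 4"
    unfolding psi_def using that
    by (intro has_tangential_traceI[OF P]) (simp_all add: psi_ref_components vector_4 K22_boundary)
  obtain a b where ab: "K22 m = poly a" "K22 n = poly b" using K22_is_poly by metis
  show "has_curl_trace P (psi P m n) (\<lambda>q. vector [0, 0, 0, 0])" if mn: "m \<in> index_set" "n \<ge> 4"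
    unfolding psi_def
    by (rule separable_curl_traceI[OF P, where a = "pderiv a" and b = b and c = 0 and d = 0
          and C = "\<lambda>q. - (deriv (K22 m) (q$1) * deriv (K22 n) (q$2))"])
      (simp_all add: psi_ref_components mn vector_4 deriv_K22_boundary four, simp_all add: ab deriv_poly)
  obtain c where c: "K22 2 = poly c" using K22_is_poly by metis
  show "has_curl_trace P (psi P m 2) (\<lambda>q. vector [0, 0, 0, 0])" if m: "m \<ge> 4"
    unfolding psi_def
    by (rule separable_curl_traceI[OF P, where a = 0 and b = 0 and c = a and d = "pderiv c"
          and C = "\<lambda>q. deriv (K22 m) (q$1) * deriv (K22 2) (q$2)"])
      (simp_all add: psi_ref_components m vector_4 deriv_K22_boundary four two, simp_all add: ab c deriv_poly)
qed

text \<open>At \<open>x = \<plusminus> 1\<close> the factor \<open>K22 k\<close> vanishes, so that the derivative of the Jacobian determinant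
  does not contribute and the determinant itself cancels against the one of the transformation.  At
  \<open>y = \<plusminus> 1\<close> the factor \<open>deriv (K22 n)\<close> vanishes.\<close>
lemma curl_edge_mode_x:
  assumes P: "convex_quad P" and n: "n \<in> index_set" and k: "k = 1 \<or> k = 3"
  shows "has_tangential_trace P (psi P k n) (\<lambda>q. vector [0, 0, 0, 0])"
    and "has_curl_trace P (psi P k n)
      (\<lambda>q. vector [deriv (K22 k) (-1) * deriv (K22 n) (q$2), 0, deriv (K22 k) 1 * deriv (K22 n) (q$2), 0])"
proof -
  have zero: "K22 k (-1) = 0" "K22 k 1 = 0" using k by (auto simp: K22_def)
  show "has_tangential_trace P (psi P k n) (\<lambda>q. vector [0, 0, 0, 0])"
    unfolding psi_def
    by (rule has_tangential_traceI[OF P]) (simp_all add: psi_ref_components(3)[OF n k] vector_4 zero)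
  obtain a b where ab: "K22 k = poly a" "K22 n = poly b" using K22_is_poly by metis
  show "has_curl_trace P (psi P k n)
      (\<lambda>q. vector [deriv (K22 k) (-1) * deriv (K22 n) (q$2), 0, deriv (K22 k) 1 * deriv (K22 n) (q$2), 0])"
    unfolding psi_def
    by (rule weighted_curl_traceI[OF P J_det_has_derivative continuous_on_wedge_col,
          where a = 0 and b = 0 and c = a and d = "pderiv b"
          and C = "\<lambda>q. wedge (col_x P q) (twist P) * (K22 k (q$1) * deriv (K22 n) (q$2))
                     + J_det P q * (deriv (K22 k) (q$1) * deriv (K22 n) (q$2))"])
      (simp_all add: psi_ref_components(3)[OF n k] vector_4 zero deriv_K22_boundary[OF n],
        simp_all add: ab deriv_poly)
qed

lemma curl_edge_mode_y:
  assumes P: "convex_quad P" and m: "m \<in> index_set" and k: "k = 1 \<or> k = 3"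
  shows "has_tangential_trace P (psi P m k) (\<lambda>q. vector [0, 0, 0, 0])"
    and "has_curl_trace P (psi P m k)
      (\<lambda>q. vector [0, - (deriv (K22 k) (-1) * deriv (K22 m) (q$1)), 0, - (deriv (K22 k) 1 * deriv (K22 m) (q$1))])"
proof -
  have zero: "K22 k (-1) = 0" "K22 k 1 = 0" using k by (auto simp: K22_def)
  show "has_tangential_trace P (psi P m k) (\<lambda>q. vector [0, 0, 0, 0])"
    unfolding psi_def
    by (rule has_tangential_traceI[OF P]) (simp_all add: psi_ref_components(4)[OF m k] vector_4 zero)
  obtain a b where ab: "K22 m = poly a" "K22 k = poly b" using K22_is_poly by metis
  show "has_curl_trace P (psi P m k)
      (\<lambda>q. vector [0, - (deriv (K22 k) (-1) * deriv (K22 m) (q$1)), 0, - (deriv (K22 k) 1 * deriv (K22 m) (q$1))])"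
    unfolding psi_def
    by (rule weighted_curl_traceI[OF P J_det_has_derivative continuous_on_wedge_col,
          where a = "pderiv a" and b = b and c = 0 and d = 0
          and C = "\<lambda>q. - (wedge (twist P) (col_y P q) * (deriv (K22 m) (q$1) * K22 k (q$2)))
                     - J_det P q * (deriv (K22 m) (q$1) * deriv (K22 k) (q$2))"])
      (simp_all add: psi_ref_components(4)[OF m k] vector_4 zero deriv_K22_boundary[OF m],
        simp_all add: ab deriv_poly)
qed

section \<open>Vertex modes\<close>

text \<open>The reference field of the vertex \<open>(\<epsilon>, \<delta>)\<close> of the square, written in the corner values of the
  Jacobian determinant: \<open>c\<close> at the vertex itself, \<open>cx\<close> and \<open>cy\<close> at its neighbours in the directions
  \<open>x\<close> and \<open>y\<close>.\<close>
definition vertex_field :: "real \<Rightarrow> real \<Rightarrow> real \<Rightarrow> real \<Rightarrow> real \<Rightarrow> real^2 \<Rightarrow> real^2" where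
  "vertex_field \<epsilon> \<delta> c cx cy q = vector
    [(- \<epsilon> * ((q$1 + \<epsilon>) * (3 * c + 2 * cx - \<epsilon> * (c + 2 * cx) * q$1)) / 32) * ((q$2 - \<delta>) * (q$2 + \<delta>)\<^sup>2),
     (\<delta> * ((q$1 - \<epsilon>) * (q$1 + \<epsilon>)\<^sup>2) / 32) * ((q$2 + \<delta>) * (3 * c + 2 * cy - \<delta> * (c + 2 * cy) * q$2))]"

lemma vertex_field_tangential:
  assumes P: "convex_quad P" and "\<epsilon> = -1 \<or> \<epsilon> = 1" "\<delta> = -1 \<or> \<delta> = 1"
  shows "has_tangential_trace P (covariant_map P (vertex_field \<epsilon> \<delta> c cx cy)) (\<lambda>q. vector [0, 0, 0, 0])"
  by (rule has_tangential_traceI[OF P]) (use assms in \<open>auto simp: vertex_field_def vector_4\<close>)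

text \<open>The cubic factors make the reference curl vanish on the two edges away from the vertex.  The
  coefficients are chosen such that on an adjacent edge it factors into a hat function and the affine
  interpolant of the corner values, which is the restriction of the Jacobian determinant.\<close>
lemma vertex_field_curl:
  assumes P: "convex_quad P" and signs: "\<epsilon> = -1 \<or> \<epsilon> = 1" "\<delta> = -1 \<or> \<delta> = 1"
    and Jx: "\<And>q. q$1 = \<epsilon> \<Longrightarrow> J_det P q = (c * (1 + \<delta> * q$2) + cy * (1 - \<delta> * q$2)) / 2"
    and Jy: "\<And>q. q$2 = \<delta> \<Longrightarrow> J_det P q = (c * (1 + \<epsilon> * q$1) + cx * (1 - \<epsilon> * q$1)) / 2"
  shows "has_curl_trace P (covariant_map P (vertex_field \<epsilon> \<delta> c cx cy)) (\<lambda>q. vector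
    [if \<epsilon> = -1 then (1 + \<delta> * q$2) / 2 else 0, if \<delta> = -1 then (1 + \<epsilon> * q$1) / 2 else 0,
     if \<epsilon> = 1 then (1 + \<delta> * q$2) / 2 else 0, if \<delta> = 1 then (1 + \<epsilon> * q$1) / 2 else 0])"
proof -
  define C where "C = (\<lambda>q::real^2.
    \<delta> * ((q$1 + \<epsilon>) * (3 * q$1 - \<epsilon>)) / 32 * ((q$2 + \<delta>) * (3 * c + 2 * cy - \<delta> * (c + 2 * cy) * q$2)) -
    (- \<epsilon> * ((q$1 + \<epsilon>) * (3 * c + 2 * cx - \<epsilon> * (c + 2 * cx) * q$1)) / 32) * ((q$2 + \<delta>) * (3 * q$2 - \<delta>)))"
  have Cx: "C q = J_det P q * ((1 + \<delta> * q$2) / 2)" if "q$1 = \<epsilon>" for q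
    unfolding C_def Jx[OF that] unfolding that using signs
    by (elim disjE) (simp_all add: field_simps)
  have Cy: "C q = J_det P q * ((1 + \<epsilon> * q$1) / 2)" if "q$2 = \<delta>" for q
    unfolding C_def Jy[OF that] unfolding that using signs
    by (elim disjE) (simp_all add: field_simps)
  have C0: "C q = 0" if "q$1 = - \<epsilon> \<or> q$2 = - \<delta>" for q
    using that by (auto simp: C_def)
  show ?thesis
  proof (rule separable_curl_traceI[OF P, where C = C
        and a = "smult (- \<epsilon> / 32) ([:\<epsilon>, 1:] * [:3 * c + 2 * cx, - \<epsilon> * (c + 2 * cx):])"
        and b = "[:- \<delta>, 1:] * [:\<delta>, 1:]\<^sup>2"
        and c = "smult (\<delta> / 32) ([:- \<epsilon>, 1:] * [:\<epsilon>, 1:]\<^sup>2)"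
        and d = "[:\<delta>, 1:] * [:3 * c + 2 * cy, - \<delta> * (c + 2 * cy):]"])
    have cubic: "poly (pderiv ([:- s, 1:] * [:s, 1:]\<^sup>2)) x = (x + s) * (3 * x - s)" for s x :: real
      by (simp add: power2_eq_square pderiv_mult pderiv_pCons algebra_simps)
    have linear: "poly [:s, t:] x = s + t * x" for s t x :: real
      by simp
    fix q :: "real^2"
    show "C q = poly (pderiv (smult (\<delta> / 32) ([:- \<epsilon>, 1:] * [:\<epsilon>, 1:]\<^sup>2))) (q$1) *
        poly ([:\<delta>, 1:] * [:3 * c + 2 * cy, - \<delta> * (c + 2 * cy):]) (q$2) -
      poly (smult (- \<epsilon> / 32) ([:\<epsilon>, 1:] * [:3 * c + 2 * cx, - \<epsilon> * (c + 2 * cx):])) (q$1) *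
        poly (pderiv ([:- \<delta>, 1:] * [:\<delta>, 1:]\<^sup>2)) (q$2)"
      unfolding pderiv_smult poly_smult cubic poly_mult linear C_def by (simp add: ac_simps)
    show "vertex_field \<epsilon> \<delta> c cx cy q $ 1 =
      poly (smult (- \<epsilon> / 32) ([:\<epsilon>, 1:] * [:3 * c + 2 * cx, - \<epsilon> * (c + 2 * cx):])) (q$1) *
        poly ([:- \<delta>, 1:] * [:\<delta>, 1:]\<^sup>2) (q$2)"
      unfolding vertex_field_def poly_smult poly_mult poly_power linear by (simp add: ac_simps)
    show "vertex_field \<epsilon> \<delta> c cx cy q $ 2 = poly (smult (\<delta> / 32) ([:- \<epsilon>, 1:] * [:\<epsilon>, 1:]\<^sup>2)) (q$1) *
        poly ([:\<delta>, 1:] * [:3 * c + 2 * cy, - \<delta> * (c + 2 * cy):]) (q$2)"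
      unfolding vertex_field_def poly_smult poly_mult poly_power linear by (simp add: ac_simps)
  qed (use signs in \<open>auto simp: vector_4 Cx Cy C0\<close>)
qed

text \<open>Each product of two edge lengths and a sine in the coefficients is four times the corner value
  of the Jacobian determinant at the angle between these edges.\<close>
lemma psi_ref_vertex:
  assumes P: "convex_quad P"
  shows "psi_ref P 0 0 = vertex_field (-1) (-1) (corner_jacobian P 1) (corner_jacobian P 2) (corner_jacobian P 4)"
    and "psi_ref P 0 1 = vertex_field 1 (-1) (corner_jacobian P 2) (corner_jacobian P 1) (corner_jacobian P 3)"
    and "psi_ref P 1 1 = vertex_field 1 1 (corner_jacobian P 3) (corner_jacobian P 4) (corner_jacobian P 2)"
    and "psi_ref P 1 0 = vertex_field (-1) 1 (corner_jacobian P 4) (corner_jacobian P 3) (corner_jacobian P 1)"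
proof -
  define c l s where "c = corner_jacobian P" and "l = edge_length P" and "s = (\<lambda>i. sin (interior_angle P i))"
  have five: "(5::4) = 1" by simp
  have angle: "l 1 * l 2 * s 1 = 4 * c 1" "l 2 * l 3 * s 2 = 4 * c 2"
    "l 3 * l 4 * s 3 = 4 * c 3" "l 4 * l 1 * s 4 = 4 * c 4"
    using sin_interior_angle[OF P, of 1] sin_interior_angle[OF P, of 2]
      sin_interior_angle[OF P, of 3] sin_interior_angle[OF P, of 4]
    unfolding c_def l_def s_def by (simp_all add: five)
  have coeff:
    "l 2 * (l 1 * s 1 + 2 * l 3 * s 2) = 4 * (c 1 + 2 * c 2)"
    "l 2 * (3 * l 1 * s 1 + 2 * l 3 * s 2) = 4 * (3 * c 1 + 2 * c 2)"
    "l 1 * (l 2 * s 1 + 2 * l 4 * s 4) = 4 * (c 1 + 2 * c 4)"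
    "l 1 * (3 * l 2 * s 1 + 2 * l 4 * s 4) = 4 * (3 * c 1 + 2 * c 4)"
    "l 2 * (2 * l 1 * s 1 + l 3 * s 2) = 4 * (2 * c 1 + c 2)"
    "l 2 * (2 * l 1 * s 1 + 3 * l 3 * s 2) = 4 * (2 * c 1 + 3 * c 2)"
    "l 3 * (l 2 * s 2 + 2 * l 4 * s 3) = 4 * (c 2 + 2 * c 3)"
    "l 3 * (3 * l 2 * s 2 + 2 * l 4 * s 3) = 4 * (3 * c 2 + 2 * c 3)"
    "- l 4 * (2 * l 1 * s 4 + l 3 * s 3) = - 4 * (2 * c 4 + c 3)"
    "l 4 * (2 * l 1 * s 4 + 3 * l 3 * s 3) = 4 * (2 * c 4 + 3 * c 3)"
    "l 3 * (2 * l 2 * s 2 + l 4 * s 3) = 4 * (2 * c 2 + c 3)"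
    "l 3 * (2 * l 2 * s 2 + 3 * l 4 * s 3) = 4 * (2 * c 2 + 3 * c 3)"
    "- l 4 * (l 1 * s 4 + 2 * l 3 * s 3) = - 4 * (c 4 + 2 * c 3)"
    "l 4 * (3 * l 1 * s 4 + 2 * l 3 * s 3) = 4 * (3 * c 4 + 2 * c 3)"
    "- l 1 * (2 * l 2 * s 1 + l 4 * s 4) = - 4 * (2 * c 1 + c 4)"
    "l 1 * (2 * l 2 * s 1 + 3 * l 4 * s 4) = 4 * (2 * c 1 + 3 * c 4)"
    using angle by (simp_all add: algebra_simps)
  have notin: "0 \<notin> index_set" "Suc 0 \<notin> index_set" by (simp_all add: index_set_def)
  have sine: "sin (interior_angle P i) = s i" for i by (simp add: s_def)
  note unfold = psi_ref_def[abs_def] Let_def c_def[symmetric] l_def[symmetric] sine coeff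
  have field:
    "vertex_field \<epsilon> \<delta> e f g = (\<lambda>q. vector [u q, w q])"
    if "\<And>q. u q = (- \<epsilon> * ((q$1 + \<epsilon>) * (3 * e + 2 * f - \<epsilon> * (e + 2 * f) * q$1)) / 32) * ((q$2 - \<delta>) * (q$2 + \<delta>)\<^sup>2)"
      "\<And>q. w q = (\<delta> * ((q$1 - \<epsilon>) * (q$1 + \<epsilon>)\<^sup>2) / 32) * ((q$2 + \<delta>) * (3 * e + 2 * g - \<delta> * (e + 2 * g) * q$2))"
    for \<epsilon> \<delta> e f g u w
    by (simp add: fun_eq_iff vertex_field_def that)
  show "psi_ref P 0 0 = vertex_field (-1) (-1) (corner_jacobian P 1) (corner_jacobian P 2) (corner_jacobian P 4)"
    unfolding unfold by (simp add: notin, rule field[symmetric]) (simp_all add: field_simps)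
  show "psi_ref P 0 1 = vertex_field 1 (-1) (corner_jacobian P 2) (corner_jacobian P 1) (corner_jacobian P 3)"
    unfolding unfold by (simp add: notin, rule field[symmetric]) (simp_all add: field_simps)
  show "psi_ref P 1 1 = vertex_field 1 1 (corner_jacobian P 3) (corner_jacobian P 4) (corner_jacobian P 2)"
    unfolding unfold by (simp add: notin, rule field[symmetric]) (simp_all add: field_simps)
  show "psi_ref P 1 0 = vertex_field (-1) 1 (corner_jacobian P 4) (corner_jacobian P 3) (corner_jacobian P 1)"
    unfolding unfold by (simp add: notin, rule field[symmetric]) (simp_all add: field_simps)
qed

lemma J_det_edge:
  "q$1 = -1 \<Longrightarrow> J_det P q = (corner_jacobian P 1 * (1 - q$2) + corner_jacobian P 4 * (1 + q$2)) / 2"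
  "q$2 = -1 \<Longrightarrow> J_det P q = (corner_jacobian P 1 * (1 - q$1) + corner_jacobian P 2 * (1 + q$1)) / 2"
  "q$1 = 1 \<Longrightarrow> J_det P q = (corner_jacobian P 2 * (1 - q$2) + corner_jacobian P 3 * (1 + q$2)) / 2"
  "q$2 = 1 \<Longrightarrow> J_det P q = (corner_jacobian P 4 * (1 - q$1) + corner_jacobian P 3 * (1 + q$1)) / 2"
  unfolding J_det_eq_sum_shape sum_4 shape_simps by (simp_all add: field_simps)

lemma vertex_mode_tangential:
  assumes P: "convex_quad P"
  shows "has_tangential_trace P (psi P 0 0) (\<lambda>q. vector [0, 0, 0, 0])"
    and "has_tangential_trace P (psi P 0 1) (\<lambda>q. vector [0, 0, 0, 0])"
    and "has_tangential_trace P (psi P 1 1) (\<lambda>q. vector [0, 0, 0, 0])"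
    and "has_tangential_trace P (psi P 1 0) (\<lambda>q. vector [0, 0, 0, 0])"
  unfolding psi_def psi_ref_vertex[OF P] by (rule vertex_field_tangential[OF P]; simp)+

lemma vertex_mode_curl:
  assumes P: "convex_quad P"
  shows "has_curl_trace P (psi P 0 0) (\<lambda>q. vector [(1 - q$2) / 2, (1 - q$1) / 2, 0, 0])"
    and "has_curl_trace P (psi P 0 1) (\<lambda>q. vector [0, (1 + q$1) / 2, (1 - q$2) / 2, 0])"
    and "has_curl_trace P (psi P 1 1) (\<lambda>q. vector [0, 0, (1 + q$2) / 2, (1 + q$1) / 2])"
    and "has_curl_trace P (psi P 1 0) (\<lambda>q. vector [(1 + q$2) / 2, 0, 0, (1 - q$1) / 2])"
proof -
  note C = vertex_field_curl[OF P]
  show "has_curl_trace P (psi P 0 0) (\<lambda>q. vector [(1 - q$2) / 2, (1 - q$1) / 2, 0, 0])"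
    unfolding psi_def psi_ref_vertex[OF P]
    using C[of "-1" "-1" "corner_jacobian P 1" "corner_jacobian P 4" "corner_jacobian P 2"] by (simp add: J_det_edge)
  show "has_curl_trace P (psi P 0 1) (\<lambda>q. vector [0, (1 + q$1) / 2, (1 - q$2) / 2, 0])"
    unfolding psi_def psi_ref_vertex[OF P]
    using C[of 1 "-1" "corner_jacobian P 2" "corner_jacobian P 3" "corner_jacobian P 1"] by (simp add: J_det_edge)
  show "has_curl_trace P (psi P 1 1) (\<lambda>q. vector [0, 0, (1 + q$2) / 2, (1 + q$1) / 2])"
    unfolding psi_def psi_ref_vertex[OF P]
    using C[of 1 1 "corner_jacobian P 3" "corner_jacobian P 2" "corner_jacobian P 4"] by (simp add: J_det_edge)
  show "has_curl_trace P (psi P 1 0) (\<lambda>q. vector [(1 + q$2) / 2, 0, 0, (1 - q$1) / 2])"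
    unfolding psi_def psi_ref_vertex[OF P]
    using C[of "-1" 1 "corner_jacobian P 4" "corner_jacobian P 1" "corner_jacobian P 3"] by (simp add: J_det_edge)
qed

theorem mainTheorem1:
  fixes P :: quad
  assumes "convex_quad P"
  shows "
    \<comment> \<open>interior modes\<close>
    (\<forall>m n. m \<ge> 2 \<and> n \<ge> 2 \<longrightarrow>
       has_tangential_trace P (phi P m n) (\<lambda>q. vector [0, 0, 0, 0]) \<and>
       has_curl_trace P (phi P m n) (\<lambda>q. vector [0, 0, 0, 0])) \<and>
    (\<forall>m n. m \<in> index_set \<and> n \<ge> 4 \<longrightarrow>
       has_tangential_trace P (psi P m n) (\<lambda>q. vector [0, 0, 0, 0]) \<and>
       has_curl_trace P (psi P m n) (\<lambda>q. vector [0, 0, 0, 0])) \<and>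
    (\<forall>m\<ge>4.
       has_tangential_trace P (psi P m 2) (\<lambda>q. vector [0, 0, 0, 0]) \<and>
       has_curl_trace P (psi P m 2) (\<lambda>q. vector [0, 0, 0, 0])) \<and>

    \<comment> \<open>function edge modes\<close>
    (\<forall>n\<ge>2.
       has_tangential_trace P (phi P 0 n)
         (\<lambda>q. vector [- (real (n - 1) * jacobi_poly 0 0 (n - 1) (q$2) / edge_length P 1), 0, 0, 0]) \<and>
       has_curl_trace P (phi P 0 n) (\<lambda>q. vector [0, 0, 0, 0])) \<and>
    (has_tangential_trace P (phi P 0 0) (\<lambda>q. vector [- (1 / edge_length P 1), 0, 0, 0]) \<and>
     has_curl_trace P (phi P 0 0) (\<lambda>q. vector [0, 0, 0, 0])) \<and>
    (\<forall>m\<ge>2.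
       has_tangential_trace P (phi P m 0)
         (\<lambda>q. vector [0, real (m - 1) * jacobi_poly 0 0 (m - 1) (q$1) / edge_length P 2, 0, 0]) \<and>
       has_curl_trace P (phi P m 0) (\<lambda>q. vector [0, 0, 0, 0])) \<and>
    (has_tangential_trace P (phi P 1 0) (\<lambda>q. vector [0, 1 / edge_length P 2, 0, 0]) \<and>
     has_curl_trace P (phi P 1 0) (\<lambda>q. vector [0, 0, 0, 0])) \<and>
    (\<forall>n\<ge>2.
       has_tangential_trace P (phi P 1 n)
         (\<lambda>q. vector [0, 0, real (n - 1) * jacobi_poly 0 0 (n - 1) (q$2) / edge_length P 3, 0]) \<and>
       has_curl_trace P (phi P 1 n) (\<lambda>q. vector [0, 0, 0, 0])) \<and>
    (has_tangential_trace P (phi P 1 1) (\<lambda>q. vector [0, 0, 1 / edge_length P 3, 0]) \<and>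
     has_curl_trace P (phi P 1 1) (\<lambda>q. vector [0, 0, 0, 0])) \<and>
    (\<forall>m\<ge>2.
       has_tangential_trace P (phi P m 1)
         (\<lambda>q. vector [0, 0, 0, - (real (m - 1) * jacobi_poly 0 0 (m - 1) (q$1) / edge_length P 4)]) \<and>
       has_curl_trace P (phi P m 1) (\<lambda>q. vector [0, 0, 0, 0])) \<and>
    (has_tangential_trace P (phi P 0 1) (\<lambda>q. vector [0, 0, 0, - (1 / edge_length P 4)]) \<and>
     has_curl_trace P (phi P 0 1) (\<lambda>q. vector [0, 0, 0, 0])) \<and>

    \<comment> \<open>curl edge modes\<close>
    (\<forall>n\<in>index_set.
       has_tangential_trace P (psi P 1 n) (\<lambda>q. vector [0, 0, 0, 0]) \<and>
       has_curl_trace P (psi P 1 n) (\<lambda>q. vector [deriv (K22 n) (q$2), 0, 0, 0])) \<and>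
    (\<forall>m\<in>index_set.
       has_tangential_trace P (psi P m 1) (\<lambda>q. vector [0, 0, 0, 0]) \<and>
       has_curl_trace P (psi P m 1) (\<lambda>q. vector [0, - deriv (K22 m) (q$1), 0, 0])) \<and>
    (\<forall>n\<in>index_set.
       has_tangential_trace P (psi P 3 n) (\<lambda>q. vector [0, 0, 0, 0]) \<and>
       has_curl_trace P (psi P 3 n) (\<lambda>q. vector [0, 0, deriv (K22 n) (q$2), 0])) \<and>
    (\<forall>m\<in>index_set.
       has_tangential_trace P (psi P m 3) (\<lambda>q. vector [0, 0, 0, 0]) \<and>
       has_curl_trace P (psi P m 3) (\<lambda>q. vector [0, 0, 0, - deriv (K22 m) (q$1)])) \<and>

    \<comment> \<open>vertex modes\<close>
    (has_tangential_trace P (psi P 0 0) (\<lambda>q. vector [0, 0, 0, 0]) \<and>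
     has_curl_trace P (psi P 0 0) (\<lambda>q. vector [(1 - q$2) / 2, (1 - q$1) / 2, 0, 0])) \<and>
    (has_tangential_trace P (psi P 0 1) (\<lambda>q. vector [0, 0, 0, 0]) \<and>
     has_curl_trace P (psi P 0 1) (\<lambda>q. vector [0, (1 + q$1) / 2, (1 - q$2) / 2, 0])) \<and>
    (has_tangential_trace P (psi P 1 1) (\<lambda>q. vector [0, 0, 0, 0]) \<and>
     has_curl_trace P (psi P 1 1) (\<lambda>q. vector [0, 0, (1 + q$2) / 2, (1 + q$1) / 2])) \<and>
    (has_tangential_trace P (psi P 1 0) (\<lambda>q. vector [0, 0, 0, 0]) \<and>
     has_curl_trace P (psi P 1 0) (\<lambda>q. vector [(1 + q$2) / 2, 0, 0, (1 - q$1) / 2]))"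
proof -
  have gradient_curl:
    "m \<ge> 2 \<Longrightarrow> n \<ge> 2 \<Longrightarrow> has_curl_trace P (phi P m n) (\<lambda>q. vector [0, 0, 0, 0])"
    "n \<ge> 2 \<Longrightarrow> has_curl_trace P (phi P 0 n) (\<lambda>q. vector [0, 0, 0, 0])"
    "n \<ge> 2 \<Longrightarrow> has_curl_trace P (phi P 1 n) (\<lambda>q. vector [0, 0, 0, 0])"
    "n \<ge> 2 \<Longrightarrow> has_curl_trace P (phi P n 0) (\<lambda>q. vector [0, 0, 0, 0])"
    "n \<ge> 2 \<Longrightarrow> has_curl_trace P (phi P n 1) (\<lambda>q. vector [0, 0, 0, 0])" for m n
    by (rule gradient_mode_curl[OF assms], simp)+
  have lowest_curl:
    "has_curl_trace P (phi P 0 0) (\<lambda>q. vector [0, 0, 0, 0])"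
    "has_curl_trace P (phi P 1 0) (\<lambda>q. vector [0, 0, 0, 0])"
    "has_curl_trace P (phi P 1 1) (\<lambda>q. vector [0, 0, 0, 0])"
    "has_curl_trace P (phi P 0 1) (\<lambda>q. vector [0, 0, 0, 0])"
    by (rule lowest_order_curl[OF assms], simp, simp)+
  have edge_tangential:
    "n \<in> index_set \<Longrightarrow> has_tangential_trace P (psi P 1 n) (\<lambda>q. vector [0, 0, 0, 0])"
    "n \<in> index_set \<Longrightarrow> has_tangential_trace P (psi P 3 n) (\<lambda>q. vector [0, 0, 0, 0])"
    "n \<in> index_set \<Longrightarrow> has_tangential_trace P (psi P n 1) (\<lambda>q. vector [0, 0, 0, 0])"
    "n \<in> index_set \<Longrightarrow> has_tangential_trace P (psi P n 3) (\<lambda>q. vector [0, 0, 0, 0])" for n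
    using curl_edge_mode_x(1)[OF assms, of n] curl_edge_mode_y(1)[OF assms, of n] by simp_all
  have edge_curl:
    "n \<in> index_set \<Longrightarrow> has_curl_trace P (psi P 1 n) (\<lambda>q. vector [deriv (K22 n) (q$2), 0, 0, 0])"
    "n \<in> index_set \<Longrightarrow> has_curl_trace P (psi P 3 n) (\<lambda>q. vector [0, 0, deriv (K22 n) (q$2), 0])"
    "n \<in> index_set \<Longrightarrow> has_curl_trace P (psi P n 1) (\<lambda>q. vector [0, - deriv (K22 n) (q$1), 0, 0])"
    "n \<in> index_set \<Longrightarrow> has_curl_trace P (psi P n 3) (\<lambda>q. vector [0, 0, 0, - deriv (K22 n) (q$1)])" for n
    using curl_edge_mode_x(2)[OF assms, of n 1, unfolded deriv_K22_boundary_odd]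
      curl_edge_mode_x(2)[OF assms, of n 3, unfolded deriv_K22_boundary_odd]
      curl_edge_mode_y(2)[OF assms, of n 1, unfolded deriv_K22_boundary_odd]
      curl_edge_mode_y(2)[OF assms, of n 3, unfolded deriv_K22_boundary_odd]
    by simp_all
  note modes =
    gradient_interior_tangential[OF assms] gradient_edge_tangential[OF assms] gradient_curl
    lowest_order_tangential[OF assms] lowest_curl
    interior_curl_mode[OF assms] edge_tangential edge_curl
    vertex_mode_tangential[OF assms] vertex_mode_curl[OF assms]
  show ?thesis
    by (intro conjI allI impI ballI; (elim conjE)?; (rule modes; assumption))
qed

end
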